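(* Let $(A,\nwarrow,\nearrow)$ be an $n$-L-dendriform algebra. Then: (1) the bracket $$\{x_1,\dots,x_n\}^h=\nwarrow(x_1,\dots,x_n)+\sum_{i=1}^{n-1}(-1)^{i+1}\nearrow(x_i,x_1,\dots,\widehat{x_i},\dots,x_n)$$ defines an $n$-pre-Lie algebra structure on $A$, called the associated horizontal $n$-pre-Lie algebra of $(A,\nwarrow,\nearrow)$; and $(A,\nwarrow,\nearrow)$ is called a compatible $n$-L-dendriform algebra structure on the $n$-pre-Lie algebra $(A,\{\cdot,\cdots,\cdot\}^h)$; (2) the bracket $$\{x_1,\dots,x_n\}^v=\nwarrow(x_1,\dots,x_n)+\sum_{i=1}^{n-1}(-1)^{i}\nearrow(x_n,x_1,\dots,\widehat{x_i},\dots,x_{n-1},x_i)$$ defines an $n$-pre-Lie algebra structure on $A$, called the associated vertical $n$-pre-Lie algebra of $(A,\nwarrow,\nearrow)$; and $(A,\nwarrow,\nearrow)$ is also called a compatible $n$-L-dendriform algebra structure on the $n$-pre-Lie algebra $(A,\{\cdot,\cdots,\cdot\}^v)$.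
   Context: $\mathbb K$ is a field of characteristic $0$; all vector spaces are finite dimensional over $\mathbb K$; $n\ge 2$ is an integer; a hat means omission. An $n$-pre-Lie algebra is a vector space $A$ with an $n$-linear map $\{\cdot,\cdots,\cdot\}:(\wedge^{n-1}A)\otimes A\to A$ (skew-symmetric in the first $n-1$ arguments) such that for all $x_i,y_i\in A$: $$\{x_1,\dots,x_{n-1},\{y_1,\dots,y_n\}\}=\sum_{i=1}^{n-1}\{y_1,\dots,y_{i-1},[x_1,\dots,x_{n-1},y_i]^C,y_{i+1},\dots,y_n\}+\{y_1,\dots,y_{n-1},\{x_1,\dots,x_{n-1},y_n\}\},$$ $$\{[x_1,\dots,x_n]^C,y_1,\dots,y_{n-1}\}=\sum_{i=1}^n(-1)^{n-i}\{x_1,\dots,\widehat{x_i},\dots,x_n,\{x_i,y_1,\dots,y_{n-1}\}\},$$ where $[x_1,\dots,x_n]^C=\sum_{i=1}^n(-1)^{n-i}\{x_1,\dots,\widehat{x_i},\dots,x_n,x_i\}$. An $n$-L-dendriform algebra is a vector space $A$ with $n$-linear maps $\nwarrow:(\wedge^{n-1}A)\otimes A\to A$ (skew-symmetric in the first $n-1$ arguments) and $\nearrow:A\otimes(\wedge^{n-2}A)\otimes A\to A$ (skew-symmetric in the middle $n-2$ arguments) such that, with $\{\cdot,\cdots,\cdot\}^h$ and $\{\cdot,\cdots,\cdot\}^v$ defined by the formulas in the claim and $[x_1,\dots,x_n]^C=\sum_{i=1}^n(-1)^{n-i}\{x_1,\dots,\widehat{x_i},\dots,x_n,x_i\}^h=\sum_{i=1}^n(-1)^{n-i}\{x_1,\dots,\widehat{x_i},\dots,x_n,x_i\}^v$,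 for all $x_i,y_i\in A$: (D1) $\nwarrow(x_1,\dots,x_{n-1},\nwarrow(y_1,\dots,y_n))-\nwarrow(y_1,\dots,y_{n-1},\nwarrow(x_1,\dots,x_{n-1},y_n))=\sum_{i=1}^{n-1}\nwarrow(y_1,\dots,y_{i-1},[x_1,\dots,x_{n-1},y_i]^C,y_{i+1},\dots,y_n)$; (D2) $\nwarrow([x_1,\dots,x_n]^C,y_1,\dots,y_{n-1})=\sum_{i=1}^n(-1)^{n-i}\nwarrow(x_1,\dots,\widehat{x_i},\dots,x_n,\nwarrow(x_i,y_1,\dots,y_{n-1}))$; (D3) $\nwarrow(x_1,\dots,x_{n-1},\nearrow(y_n,y_1,\dots,y_{n-1}))-\nearrow(y_n,y_1,\dots,y_{n-2},\{x_1,\dots,x_{n-1},y_{n-1}\}^h)=\nearrow(\{x_1,\dots,x_{n-1},y_n\}^v,y_1,\dots,y_{n-1})+\sum_{i=1}^{n-2}\nearrow(y_n,y_1,\dots,y_{i-1},[x_1,\dots,x_{n-1},y_i]^C,y_{i+1},\dots,y_{n-1})$; (D4) $\nearrow(y_{n-1},[x_1,\dots,x_n]^C,y_1,\dots,y_{n-2})=\sum_{i=1}^n(-1)^{n-i}\nwarrow(x_1,\dots,\widehat{x_i},\dots,x_n,\nearrow(y_{n-1},x_i,y_1,\dots,y_{n-2}))$; (D5) $\nearrow(x_{n-1},x_1,\dots,x_{n-2},\{y_1,\dots,y_n\}^h)-\nwarrow(y_1,\dots,y_{n-1},\nearrow(x_{n-1},x_1,\dots,x_{n-2},y_n))=\sum_{i=1}^{n-1}(-1)^{i+1}\nearrow(\{x_1,\dots,x_{n-2},y_i,x_{n-1}\}^v,y_1,\dots,\widehat{y_i},\dots,y_n)$;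 (D6) $\nearrow(\{x_1,\dots,x_{n-1},y_n\}^v,y_1,\dots,y_{n-1})-\nwarrow(x_1,\dots,x_{n-1},\nearrow(y_n,y_1,\dots,y_{n-1}))=\sum_{i=1}^{n-1}(-1)^i\nearrow(y_n,x_1,\dots,\widehat{x_i},\dots,x_{n-1},\{x_i,y_1,\dots,y_{n-1}\}^h)$. *)

theory Defs
  imports Complex_Main
begin

text \<open>
  An \<open>n\<close>-ary operation on \<open>A\<close> is a function on lists over \<open>'a\<close>; only its values on lists of
  length \<open>n\<close> matter. Indices \<open>i\<close> in sums start at 1, so that all signs can be read as usual;
  the entry \<open>x\<^sub>i\<close> of a list \<open>xs\<close> is therefore \<open>xs ! (i - 1)\<close>.
\<close>

definition omit :: "nat \<Rightarrow> 'a list \<Rightarrow> 'a list" where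
  "omit i xs = take (i - 1) xs @ drop i xs"

definition multilinear ::
    "('k::field \<Rightarrow> 'a::ab_group_add \<Rightarrow> 'a) \<Rightarrow> nat \<Rightarrow> ('a list \<Rightarrow> 'a) \<Rightarrow> bool" where
  "multilinear scale n f \<longleftrightarrow>
     (\<forall>xs i. length xs = n \<longrightarrow> i < n \<longrightarrow> Vector_Spaces.linear scale scale (\<lambda>z. f (xs[i := z])))"

text \<open>Here \<open>I\<close> is a set of list positions, counted from 0.\<close>

definition skew_symmetric_in :: "nat set \<Rightarrow> nat \<Rightarrow> ('a list \<Rightarrow> 'a::ab_group_add) \<Rightarrow> bool" where
  "skew_symmetric_in I n f \<longleftrightarrow>
     (\<forall>xs i j. length xs = n \<longrightarrow> i \<in> I \<longrightarrow> j \<in> I \<longrightarrow> i \<noteq> j \<longrightarrow>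
        f (xs[i := xs ! j, j := xs ! i]) = - f xs)"

definition n_commutator ::
    "('k::field \<Rightarrow> 'a::ab_group_add \<Rightarrow> 'a) \<Rightarrow> nat \<Rightarrow> ('a list \<Rightarrow> 'a) \<Rightarrow> 'a list \<Rightarrow> 'a" where
  "n_commutator scale n br xs =
     (\<Sum>i=1..n. scale ((-1) ^ (n - i)) (br (omit i xs @ [xs ! (i - 1)])))"

locale n_pre_lie_algebra = finite_dimensional_vector_space scale Basis
  for scale :: "'k::field_char_0 \<Rightarrow> 'a::ab_group_add \<Rightarrow> 'a" (infixr \<open>*s\<close> 75)
    and Basis :: "'a set" +
  fixes n :: nat
    and br :: "'a list \<Rightarrow> 'a"
  assumes n_ge_2: "n \<ge> 2"
    and br_multilinear: "multilinear (*s) n br"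
    and br_skew: "skew_symmetric_in {0..<n-1} n br"
    and br_br: "\<And>xs ys z. length xs = n - 1 \<Longrightarrow> length ys = n - 1 \<Longrightarrow>
      br (xs @ [br (ys @ [z])]) =
        (\<Sum>i=1..n-1. br (ys[i - 1 := n_commutator (*s) n br (xs @ [ys ! (i - 1)])] @ [z]))
        + br (ys @ [br (xs @ [z])])"
    and br_commutator: "\<And>xs ys. length xs = n \<Longrightarrow> length ys = n - 1 \<Longrightarrow>
      br (n_commutator (*s) n br xs # ys) =
        (\<Sum>i=1..n. (-1) ^ (n - i) *s br (omit i xs @ [br (xs ! (i - 1) # ys)]))"

definition horizontal_bracket ::
    "('k::field \<Rightarrow> 'a::ab_group_add \<Rightarrow> 'a) \<Rightarrow> nat \<Rightarrow> ('a list \<Rightarrow> 'a) \<Rightarrow> ('a list \<Rightarrow> 'a)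
      \<Rightarrow> 'a list \<Rightarrow> 'a" where
  "horizontal_bracket scale n nw ne xs =
     nw xs + (\<Sum>i=1..n-1. scale ((-1) ^ (i + 1)) (ne (xs ! (i - 1) # omit i xs)))"

definition vertical_bracket ::
    "('k::field \<Rightarrow> 'a::ab_group_add \<Rightarrow> 'a) \<Rightarrow> nat \<Rightarrow> ('a list \<Rightarrow> 'a) \<Rightarrow> ('a list \<Rightarrow> 'a)
      \<Rightarrow> 'a list \<Rightarrow> 'a" where
  "vertical_bracket scale n nw ne xs =
     nw xs + (\<Sum>i=1..n-1. scale ((-1) ^ i)
       (ne (xs ! (n - 1) # omit i (butlast xs) @ [xs ! (i - 1)])))"

lemma length_omit: "1 \<le> i \<Longrightarrow> i \<le> length xs \<Longrightarrow> length (omit i xs) = length xs - 1"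
  by (auto simp: omit_def)

lemma nth_omit:
  "1 \<le> i \<Longrightarrow> i \<le> length xs \<Longrightarrow> 1 \<le> k \<Longrightarrow> k \<le> length xs - 1 \<Longrightarrow>
    omit i xs ! (k - 1) = (if k < i then xs ! (k - 1) else xs ! k)"
  by (auto simp: omit_def nth_append min_def)

lemma omit_append: "1 \<le> k \<Longrightarrow> k \<le> length xs \<Longrightarrow> omit k (xs @ ys) = omit k xs @ ys"
  by (auto simp: omit_def)

lemma omit_omit:
  assumes "1 \<le> i" "i < j" "j \<le> length xs"
  shows "omit i (omit j xs) = omit (j - 1) (omit i xs)"
proof (rule nth_equalityI)
  show "length (omit i (omit j xs)) = length (omit (j - 1) (omit i xs))"
    using assms by (simp add: length_omit)
next
  fix k assume "k < length (omit i (omit j xs))"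
  then have k: "k < length xs - 2" using assms by (simp add: length_omit)
  have l: "length (omit j xs) = length xs - 1" "length (omit i xs) = length xs - 1"
    using assms by (simp_all add: length_omit)
  have a: "\<And>p zs m. 1 \<le> p \<Longrightarrow> p \<le> length zs \<Longrightarrow> m < length zs - 1 \<Longrightarrow>
      omit p zs ! m = (if Suc m < p then zs ! m else zs ! Suc m)"
    by (auto simp: omit_def nth_append min_def)
  show "omit i (omit j xs) ! k = omit (j - 1) (omit i xs) ! k"
    using assms k l by (auto simp: a)
qed

text \<open>
  The horizontal and the vertical bracket always have the same commutator, so the bracket
  \<open>[x\<^sub>1, \<dots>, x\<^sub>n]\<^sup>C\<close> of an \<open>n\<close>-L-dendriform algebra may be defined from either one.
\<close>

lemma n_commutator_horizontal_eq_vertical: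
  fixes scale :: "'k::field \<Rightarrow> 'a::ab_group_add \<Rightarrow> 'a"
  assumes vs: "vector_space scale" and len: "length xs = n"
  shows "n_commutator scale n (horizontal_bracket scale n nw ne) xs =
         n_commutator scale n (vertical_bracket scale n nw ne) xs"
proof -
  interpret vector_space scale by (fact vs)
  define D where "D i = {1..n} - {i}" for i :: nat
  define w where "w i j = (if i < j then omit i (omit j xs) else omit j (omit i xs))" for i j
  define t where "t i j = ne (xs ! (j - 1) # w i j @ [xs ! (i - 1)])" for i j
  define e where "e i j = (if j < i then j else j - 1)" for i j :: nat
  have ww: "w i j = w j i" if "i \<noteq> j" for i j using that by (auto simp: w_def)
  have re: "(\<Sum>k=1..n-1. g k) = (\<Sum>j\<in>D i. g (e i j))" if "i \<in> {1..n}" for i and g :: "nat \<Rightarrow> 'a"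
    using that
    by (intro sum.reindex_bij_witness[where i = "\<lambda>j. e i j" and j = "\<lambda>k. if k < i then k else k + 1"])
       (auto simp: D_def e_def)
  have om: "omit (e i j) (omit i xs) = w i j" if "i \<in> {1..n}" "j \<in> D i" for i j
    using that len by (auto simp: e_def w_def D_def omit_omit)
  have nt: "omit i xs ! (e i j - 1) = xs ! (j - 1)" if "i \<in> {1..n}" "j \<in> D i" for i j
    using that len by (subst nth_omit) (auto simp: e_def D_def)
  have H: "horizontal_bracket scale n nw ne (omit i xs @ [xs ! (i - 1)]) =
      nw (omit i xs @ [xs ! (i - 1)]) + (\<Sum>j\<in>D i. scale ((-1) ^ (e i j + 1)) (t i j))"
    if i: "i \<in> {1..n}" for i
  proof -
    have "(omit i xs @ [xs ! (i - 1)]) ! (e i j - 1) # omit (e i j) (omit i xs @ [xs ! (i - 1)])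
        = xs ! (j - 1) # w i j @ [xs ! (i - 1)]" if j: "j \<in> D i" for j
    proof -
      have "1 \<le> e i j" "e i j \<le> n - 1" "length (omit i xs) = n - 1"
        using i j len by (auto simp: e_def D_def length_omit)
      then show ?thesis using om[OF i j] nt[OF i j] by (auto simp: omit_append nth_append)
    qed
    then show ?thesis unfolding horizontal_bracket_def re[OF i] t_def by simp
  qed
  have V: "vertical_bracket scale n nw ne (omit i xs @ [xs ! (i - 1)]) =
      nw (omit i xs @ [xs ! (i - 1)]) + (\<Sum>j\<in>D i. scale ((-1) ^ e i j) (t j i))"
    if i: "i \<in> {1..n}" for i
  proof -
    have l: "length (omit i xs) = n - 1" using i len by (auto simp: length_omit)
    have "(omit i xs @ [xs ! (i - 1)]) ! (e i j - 1) = xs ! (j - 1)" if j: "j \<in> D i" for j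
    proof -
      have "1 \<le> e i j" "e i j \<le> n - 1"
        using i j len by (auto simp: e_def D_def)
      then show ?thesis using l nt[OF i j] by (auto simp: nth_append)
    qed
    moreover have "(omit i xs @ [xs ! (i - 1)]) ! (n - 1) = xs ! (i - 1)"
      using l by (auto simp: nth_append)
    ultimately show ?thesis
      unfolding vertical_bracket_def re[OF i] t_def using om[OF i] ww
      by (auto intro!: sum.cong simp: D_def)
  qed
  have sgn: "(-1) ^ (n - i) * (-1) ^ (e i j + 1) = ((-1) ^ (n - j) * (-1) ^ e j i :: 'k)"
    if "i \<in> {1..n}" "j \<in> {1..n}" "i \<noteq> j" for i j
  proof -
    have "even (n - i + (e i j + 1)) = even (n - j + e j i)"
      using that by (auto simp: e_def)
    then show ?thesis unfolding power_add[symmetric] by (metis neg_one_even_power neg_one_odd_power)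
  qed
  have swap: "(\<Sum>i=1..n. \<Sum>j\<in>D i. f i j) = (\<Sum>i=1..n. \<Sum>j\<in>D i. f j i)" for f :: "nat \<Rightarrow> nat \<Rightarrow> 'a"
  proof -
    have D: "(\<Sum>j\<in>D i. f i j) = (\<Sum>j=1..n. if i \<noteq> j then f i j else 0)"
      for i and f :: "nat \<Rightarrow> nat \<Rightarrow> 'a"
      unfolding D_def by (rule sum.mono_neutral_cong_left) auto
    have "(\<Sum>i=1..n. \<Sum>j\<in>D i. f i j) = (\<Sum>j=1..n. \<Sum>i=1..n. if i \<noteq> j then f i j else 0)"
      unfolding D by (rule sum.swap)
    also have "\<dots> = (\<Sum>i=1..n. \<Sum>j\<in>D i. f j i)"
      unfolding D[of "\<lambda>i j. f j i"] by (intro sum.cong refl) auto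
    finally show ?thesis .
  qed
  have "(\<Sum>i=1..n. \<Sum>j\<in>D i. scale ((-1) ^ (n - i) * (-1) ^ (e i j + 1)) (t i j))
      = (\<Sum>i=1..n. \<Sum>j\<in>D i. scale ((-1) ^ (n - j) * (-1) ^ e j i) (t i j))"
  proof (intro sum.cong refl)
    fix i j assume "i \<in> {1..n}" "j \<in> D i"
    then show "scale ((-1) ^ (n - i) * (-1) ^ (e i j + 1)) (t i j) =
        scale ((-1) ^ (n - j) * (-1) ^ e j i) (t i j)"
      using sgn[of i j] unfolding D_def by (metis Diff_iff insertI1)
  qed
  also have "\<dots> = (\<Sum>i=1..n. \<Sum>j\<in>D i. scale ((-1) ^ (n - i) * (-1) ^ e i j) (t j i))"
    by (rule swap)
  finally have eq: "(\<Sum>i=1..n. \<Sum>j\<in>D i. scale ((-1) ^ (n - i) * (-1) ^ (e i j + 1)) (t i j))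
      = (\<Sum>i=1..n. \<Sum>j\<in>D i. scale ((-1) ^ (n - i) * (-1) ^ e i j) (t j i))" .
  have ch: "n_commutator scale n (horizontal_bracket scale n nw ne) xs =
      (\<Sum>i=1..n. scale ((-1) ^ (n - i)) (nw (omit i xs @ [xs ! (i - 1)])))
      + (\<Sum>i=1..n. \<Sum>j\<in>D i. scale ((-1) ^ (n - i) * (-1) ^ (e i j + 1)) (t i j))"
    unfolding n_commutator_def sum.distrib[symmetric]
    by (rule sum.cong[OF refl], subst H) (simp_all add: scale_right_distrib scale_sum_right)
  have cv: "n_commutator scale n (vertical_bracket scale n nw ne) xs =
      (\<Sum>i=1..n. scale ((-1) ^ (n - i)) (nw (omit i xs @ [xs ! (i - 1)])))
      + (\<Sum>i=1..n. \<Sum>j\<in>D i. scale ((-1) ^ (n - i) * (-1) ^ e i j) (t j i))"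
    unfolding n_commutator_def sum.distrib[symmetric]
    by (rule sum.cong[OF refl], subst V) (simp_all add: scale_right_distrib scale_sum_right)
  show ?thesis unfolding ch cv eq ..
qed

locale n_L_dendriform_algebra = finite_dimensional_vector_space scale Basis
  for scale :: "'k::field_char_0 \<Rightarrow> 'a::ab_group_add \<Rightarrow> 'a" (infixr \<open>*s\<close> 75)
    and Basis :: "'a set" +
  fixes n :: nat
    and nw :: "'a list \<Rightarrow> 'a" (\<open>\<nwarrow>\<close>)
    and ne :: "'a list \<Rightarrow> 'a" (\<open>\<nearrow>\<close>)
    and h v C :: "'a list \<Rightarrow> 'a"
  defines "h \<equiv> horizontal_bracket (*s) n \<nwarrow> \<nearrow>"
    and "v \<equiv> vertical_bracket (*s) n \<nwarrow> \<nearrow>"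
    and "C \<equiv> n_commutator (*s) n h"
  assumes n_ge_2: "n \<ge> 2"
    and nw_multilinear: "multilinear (*s) n \<nwarrow>"
    and ne_multilinear: "multilinear (*s) n \<nearrow>"
    and nw_skew: "skew_symmetric_in {0..<n-1} n \<nwarrow>"
    and ne_skew: "skew_symmetric_in {1..<n-1} n \<nearrow>"
    and D1: "\<And>xs ys z. length xs = n - 1 \<Longrightarrow> length ys = n - 1 \<Longrightarrow>
      \<nwarrow> (xs @ [\<nwarrow> (ys @ [z])]) - \<nwarrow> (ys @ [\<nwarrow> (xs @ [z])]) =
        (\<Sum>i=1..n-1. \<nwarrow> (ys[i - 1 := C (xs @ [ys ! (i - 1)])] @ [z]))"
    and D2: "\<And>xs ys. length xs = n \<Longrightarrow> length ys = n - 1 \<Longrightarrow>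
      \<nwarrow> (C xs # ys) = (\<Sum>i=1..n. (-1) ^ (n - i) *s \<nwarrow> (omit i xs @ [\<nwarrow> (xs ! (i - 1) # ys)]))"
    \<comment> \<open>In \<open>D3\<close>, \<open>a\<close> is \<open>y\<^sub>n\<close>, \<open>b\<close> is \<open>y\<^sub>n\<^sub>-\<^sub>1\<close> and \<open>ys\<close> is the list of the remaining \<open>y\<^sub>i\<close>.\<close>
    and D3: "\<And>xs ys a b. length xs = n - 1 \<Longrightarrow> length ys = n - 2 \<Longrightarrow>
      \<nwarrow> (xs @ [\<nearrow> (a # ys @ [b])]) - \<nearrow> (a # ys @ [h (xs @ [b])]) =
        \<nearrow> (v (xs @ [a]) # ys @ [b])
        + (\<Sum>i=1..n-2. \<nearrow> (a # ys[i - 1 := C (xs @ [ys ! (i - 1)])] @ [b]))"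
    and D4: "\<And>xs ys a. length xs = n \<Longrightarrow> length ys = n - 2 \<Longrightarrow>
      \<nearrow> (a # C xs # ys) =
        (\<Sum>i=1..n. (-1) ^ (n - i) *s \<nwarrow> (omit i xs @ [\<nearrow> (a # xs ! (i - 1) # ys)]))"
    \<comment> \<open>In \<open>D5\<close>, \<open>a\<close> is \<open>x\<^sub>n\<^sub>-\<^sub>1\<close> and \<open>z\<close> is \<open>y\<^sub>n\<close>; in \<open>D6\<close>, \<open>a\<close> is \<open>y\<^sub>n\<close>.\<close>
    and D5: "\<And>xs ys a z. length xs = n - 2 \<Longrightarrow> length ys = n - 1 \<Longrightarrow>
      \<nearrow> (a # xs @ [h (ys @ [z])]) - \<nwarrow> (ys @ [\<nearrow> (a # xs @ [z])]) =
        (\<Sum>i=1..n-1. (-1) ^ (i + 1) *s \<nearrow> (v (xs @ [ys ! (i - 1), a]) # omit i ys @ [z]))"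
    and D6: "\<And>xs ys a. length xs = n - 1 \<Longrightarrow> length ys = n - 1 \<Longrightarrow>
      \<nearrow> (v (xs @ [a]) # ys) - \<nwarrow> (xs @ [\<nearrow> (a # ys)]) =
        (\<Sum>i=1..n-1. (-1) ^ i *s \<nearrow> (a # omit i xs @ [h (xs ! (i - 1) # ys)]))"

text \<open>
  An \<open>n\<close>-L-dendriform structure is called compatible with an \<open>n\<close>-pre-Lie algebra if the latter is
  its associated horizontal or its associated vertical \<open>n\<close>-pre-Lie algebra.
\<close>

definition compatible_n_L_dendriform ::
    "('k::field_char_0 \<Rightarrow> 'a::ab_group_add \<Rightarrow> 'a) \<Rightarrow> 'a set \<Rightarrow> nat \<Rightarrow> ('a list \<Rightarrow> 'a)
      \<Rightarrow> ('a list \<Rightarrow> 'a) \<Rightarrow> ('a list \<Rightarrow> 'a) \<Rightarrow> bool" where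
  "compatible_n_L_dendriform scale Basis n br nw ne \<longleftrightarrow>
     n_pre_lie_algebra scale Basis n br \<and> n_L_dendriform_algebra scale Basis n nw ne \<and>
     ((\<forall>xs. length xs = n \<longrightarrow> br xs = horizontal_bracket scale n nw ne xs) \<or>
      (\<forall>xs. length xs = n \<longrightarrow> br xs = vertical_bracket scale n nw ne xs))"

end

theory Submission
  imports Defs
begin

text \<open>
  Every bracket, commutator and axiom is an alternating sum over the entries of a list, so both
  pre-Lie identities follow from two rules: alternating sums over different lists commute, and
  exchanging the two entries extracted by a double alternating sum over one list changes the sign.
  This uses \<open>D5\<close> with the sign \<open>(-1)\<^sup>n\<^sup>+\<^sup>1\<close>. For odd \<open>n\<close> that is the given axiom. For even \<open>n\<close> the
  axioms force both sides to vanish: fix \<open>a\<close> and \<open>z\<close>, and consider \<open>\<nearrow>({M, a}\<^sup>v, N, z)\<close> as a function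
  of the set \<open>M\<close> of \<open>n - 1\<close> out of \<open>2 n - 3\<close> letters. \<open>D3\<close>--\<open>D6\<close> give \<open>(\<A> + 1) \<A>\<^sup>2 G = 0\<close> for this function \<open>G\<close>,
  where \<open>\<A>\<close> is the adjacency operator of an odd graph, and for even \<open>n\<close> neither \<open>0\<close> nor \<open>-1\<close> is an
  eigenvalue of \<open>\<A>\<close>.
\<close>

section \<open>Alternating sums over the entries of a list\<close>

text \<open>The sign in \<open>D5\<close> matters for this reason: \<open>C (xs @ [y])\<close>
  equals \<open>br (xs @ [y])\<close> minus an alternating sum of \<open>br (y # l @ [x])\<close>,
  free of the parity of \<open>n\<close> and with \<open>y\<close> in front, while \<open>D5\<close>
  places \<open>y\<close> behind the other entries; moving it costs (-1)^n. As \<open>C\<close> is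
  the commutator of both brackets, it can be expanded through \<open>v\<close> in the first slot of
  \<nearrow> and through \<open>h\<close> in the last slot. These are the brackets that
  \<open>D3\<close>, \<open>D5\<close> and \<open>D6\<close> have there, and so the terms cancel.
  Entries of a list may coincide, so a function of a set of letters has to be a function of their
  positions, and a skew-symmetric function descends to sets only after multiplication by the sign of
  the arrangement. Sums are defined by recursion on the list so that commuting and exchanging them
  needs no index arithmetic. Characteristic 0 makes the nonzero integers invertible that occur while
  the eigenvalue equations are solved.\<close>

primrec alternating_sum :: "'b list \<Rightarrow> ('b \<Rightarrow> 'b list \<Rightarrow> 'a::ab_group_add) \<Rightarrow> 'a" where
  "alternating_sum [] f = 0"
| "alternating_sum (x # xs) f = f x xs - alternating_sum xs (\<lambda>y l. f y (x # l))"

primrec derivation_sum :: "('b \<Rightarrow> 'b) \<Rightarrow> 'b list \<Rightarrow> ('b list \<Rightarrow> 'a::ab_group_add) \<Rightarrow> 'a" where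
  "derivation_sum c [] f = 0"
| "derivation_sum c (x # xs) f = f (c x # xs) + derivation_sum c xs (\<lambda>l. f (x # l))"

text \<open>Adjacent swaps generate all permutations, and fixing the length suits operations whose
  values on lists of other lengths are arbitrary.\<close>

definition skew_on_length :: "nat \<Rightarrow> ('b list \<Rightarrow> 'a::ab_group_add) \<Rightarrow> bool" where
  "skew_on_length k f \<longleftrightarrow>
     (\<forall>us a b vs. Suc (Suc (length us + length vs)) = k \<longrightarrow>
        f (us @ b # a # vs) = - f (us @ a # b # vs))"

lemma alternating_sum_cong:
  assumes "\<And>x l. Suc (length l) = length xs \<Longrightarrow> f x l = g x l"
  shows "alternating_sum xs f = alternating_sum xs g"
  using assms
proof (induction xs arbitrary: f g)
  case (Cons x xs)
  have "alternating_sum xs (\<lambda>y l. f y (x # l)) = alternating_sum xs (\<lambda>y l. g y (x # l))"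
    by (rule Cons.IH) (simp add: Cons.prems)
  then show ?case by (simp add: Cons.prems)
qed simp

lemma alternating_sum_add:
  "alternating_sum xs (\<lambda>x l. f x l + g x l) = alternating_sum xs f + alternating_sum xs g"
  by (induction xs arbitrary: f g) (simp_all add: algebra_simps)

lemma alternating_sum_minus:
  "alternating_sum xs (\<lambda>x l. - f x l) = - alternating_sum xs f"
  by (induction xs arbitrary: f) (simp_all add: algebra_simps)

lemma alternating_sum_diff:
  "alternating_sum xs (\<lambda>x l. f x l - g x l) = alternating_sum xs f - alternating_sum xs g"
  by (induction xs arbitrary: f g) (simp_all add: algebra_simps)

lemma alternating_sum_zero [simp]: "alternating_sum xs (\<lambda>x l. 0) = 0"
  by (induction xs) simp_all

lemma additive_alternating_sum:
  assumes "\<And>x y. F (x + y) = F x + F (y :: 'a::ab_group_add)"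
  shows "F (alternating_sum xs f) = (alternating_sum xs (\<lambda>x l. F (f x l)) :: 'c::ab_group_add)"
proof (induction xs arbitrary: f)
  case Nil
  show ?case using assms[of 0 0] by simp
next
  case (Cons x xs)
  have "F (u - w) = F u - F w" for u w
    using assms[of "u - w" w] by (simp add: algebra_simps)
  then show ?case by (simp add: Cons.IH)
qed

lemma alternating_sum_commute:
  "alternating_sum xs (\<lambda>x l. alternating_sum ys (\<lambda>y r. f x l y r)) =
   alternating_sum ys (\<lambda>y r. alternating_sum xs (\<lambda>x l. f x l y r))"
  by (induction xs arbitrary: f) (simp_all add: alternating_sum_diff)

text \<open>Removing the earlier of two entries shifts the later one by one position, so the two
  orders of extraction carry opposite signs.\<close>

lemma alternating_sum_swap:
  "alternating_sum xs (\<lambda>x l. alternating_sum l (\<lambda>y r. f x y r)) =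
   - alternating_sum xs (\<lambda>x l. alternating_sum l (\<lambda>y r. f y x r))"
proof (induction xs arbitrary: f)
  case (Cons a xs)
  show ?case using Cons.IH[of "\<lambda>x y r. f x y (a # r)"]
    by (simp add: alternating_sum_diff)
qed simp

lemma alternating_sum_snoc:
  "alternating_sum (xs @ [y]) f = alternating_sum xs (\<lambda>x l. f x (l @ [y]))
     + (if even (length xs) then f y xs else - f y xs)"
  by (induction xs arbitrary: f) (simp_all add: algebra_simps)

lemma alternating_sum_map:
  "alternating_sum (map x xs) f = alternating_sum xs (\<lambda>i l. f (x i) (map x l))"
  by (induction xs arbitrary: f) simp_all

text \<open>Bridge from \<open>exchange\<close> to \<open>odd_graph_sum\<close>: the position sign
  of the extracted entry cancels against the sign carried by \<open>f\<close>, and an unsigned sum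
  remains.\<close>

lemma alternating_sum_eq_sum_set:
  assumes "distinct xs"
    and "\<And>us m vs. xs = us @ m # vs \<Longrightarrow>
      f m (us @ vs) = (if even (length us) then g m else - g m)"
  shows "alternating_sum xs f = (\<Sum>m\<in>set xs. g m)"
  using assms
proof (induction xs arbitrary: f g)
  case (Cons a xs)
  have "alternating_sum xs (\<lambda>y l. - f y (a # l)) = (\<Sum>m\<in>set xs. g m)"
  proof (rule Cons.IH)
    show "distinct xs" using Cons.prems(1) by simp
    fix us m vs assume "xs = us @ m # vs"
    then show "- f m (a # us @ vs) = (if even (length us) then g m else - g m)"
      using Cons.prems(2)[of "a # us" m vs] by auto
  qed
  moreover have "f a xs = g a" using Cons.prems(2)[of "[]" a xs] by simp
  ultimately show ?case using Cons.prems(1) by (simp add: alternating_sum_minus)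
qed simp

lemma derivation_sum_cong:
  assumes "\<And>l. length l = length xs \<Longrightarrow> f l = g l"
  shows "derivation_sum c xs f = derivation_sum c xs g"
  using assms
proof (induction xs arbitrary: f g)
  case (Cons x xs)
  have "derivation_sum c xs (\<lambda>l. f (x # l)) = derivation_sum c xs (\<lambda>l. g (x # l))"
    by (rule Cons.IH) (simp add: Cons.prems)
  then show ?case by (simp add: Cons.prems)
qed simp

lemma derivation_sum_add:
  "derivation_sum c xs (\<lambda>l. f l + g l) = derivation_sum c xs f + derivation_sum c xs g"
  by (induction xs arbitrary: f g) (simp_all add: algebra_simps)

lemma derivation_sum_diff:
  "derivation_sum c xs (\<lambda>l. f l - g l) = derivation_sum c xs f - derivation_sum c xs g"
  by (induction xs arbitrary: f g) (simp_all add: algebra_simps)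

lemma derivation_sum_eq_sum:
  "derivation_sum c xs f = (\<Sum>i=1..length xs. f (xs[i - 1 := c (xs ! (i - 1))]))"
proof (induction xs arbitrary: f)
  case (Cons x xs)
  have "(\<Sum>i=1..length (x # xs). f ((x # xs)[i - 1 := c ((x # xs) ! (i - 1))]))
      = f (c x # xs) + (\<Sum>i=Suc 1..Suc (length xs). f ((x # xs)[i - 1 := c ((x # xs) ! (i - 1))]))"
    by (subst sum.atLeast_Suc_atMost) simp_all
  also have "(\<Sum>i=Suc 1..Suc (length xs). f ((x # xs)[i - 1 := c ((x # xs) ! (i - 1))]))
      = (\<Sum>i=1..length xs. f (x # xs[i - 1 := c (xs ! (i - 1))]))"
    unfolding sum.shift_bounds_cl_Suc_ivl
    by (intro sum.cong refl) (auto simp: list_update.simps split: nat.splits)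
  finally show ?case by (simp add: Cons.IH)
qed simp

text \<open>Leibniz rule: the entry changed by \<open>c\<close> is either the extracted one or one
  of those left behind.\<close>

lemma derivation_sum_alternating_sum:
  "derivation_sum c xs (\<lambda>l. alternating_sum l f) =
   alternating_sum xs (\<lambda>x l. f (c x) l)
     + alternating_sum xs (\<lambda>x l. derivation_sum c l (f x))"
  by (induction xs arbitrary: f)
    (simp_all add: derivation_sum_diff alternating_sum_add algebra_simps)

section \<open>Moving entries and blocks inside skew-symmetric functions\<close>

lemma skew_on_lengthD:
  "skew_on_length k f \<Longrightarrow> Suc (Suc (length us + length vs)) = k \<Longrightarrow>
    f (us @ b # a # vs) = - f (us @ a # b # vs)"
  unfolding skew_on_length_def by blast

lemma skew_on_length_Cons:
  fixes f :: "'a list \<Rightarrow> 'b::ab_group_add"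
  shows "skew_on_length (Suc k) f \<Longrightarrow> skew_on_length k (\<lambda>l. f (x # l))"
  unfolding skew_on_length_def
proof (intro allI impI)
  fix us vs :: "'a list" and a b
  assume "\<forall>us a b vs. Suc (Suc (length us + length vs)) = Suc k \<longrightarrow>
      f (us @ b # a # vs) = - f (us @ a # b # vs)"
    and "Suc (Suc (length us + length vs)) = k"
  from this(1)[rule_format, of "x # us" vs b a] this(2)
  show "f (x # us @ b # a # vs) = - f (x # us @ a # b # vs)" by simp
qed

lemma skew_move:
  assumes "skew_on_length k f" "Suc (length us + length ws + length vs) = k"
  shows "f (us @ a # ws @ vs) = (if even (length ws) then f (us @ ws @ a # vs) else - f (us @ ws @ a # vs))"
  using assms(2)
proof (induction ws arbitrary: us)
  case (Cons w ws)
  have "f (us @ a # (w # ws) @ vs) = - f ((us @ [w]) @ a # ws @ vs)"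
    using skew_on_lengthD[OF assms(1), of us "ws @ vs" a w] Cons.prems by simp
  also have "f ((us @ [w]) @ a # ws @ vs) = (if even (length ws) then f ((us @ [w]) @ ws @ a # vs)
      else - f ((us @ [w]) @ ws @ a # vs))"
    by (rule Cons.IH) (use Cons.prems in simp)
  finally show ?case by simp
qed simp

lemma skew_block_move:
  assumes "skew_on_length k f" "length us + length as + length bs + length vs = k"
  shows "f (us @ as @ bs @ vs) = (if even (length as * length bs) then f (us @ bs @ as @ vs)
    else - f (us @ bs @ as @ vs))"
  using assms(2)
proof (induction as arbitrary: vs rule: rev_induct)
  case (snoc a as)
  have "f (us @ (as @ [a]) @ bs @ vs) =
    (if even (length bs) then f (us @ as @ bs @ a # vs) else - f (us @ as @ bs @ a # vs))"
    using skew_move[OF assms(1), of "us @ as" bs vs a] snoc.prems by simp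
  also have "f (us @ as @ bs @ (a # vs)) = (if even (length as * length bs)
      then f (us @ bs @ as @ (a # vs)) else - f (us @ bs @ as @ (a # vs)))"
    by (rule snoc.IH) (use snoc.prems in simp)
  finally show ?case by auto
qed simp

text \<open>Swapping the neighbours \<open>a\<close> and \<open>b\<close> flips every term that
  extracts neither of them and interchanges the two terms that extract one of them, whose positions
  have opposite signs.\<close>

lemma skew_on_length_alternating_sum:
  fixes f :: "'b \<Rightarrow> 'b list \<Rightarrow> 'a::ab_group_add"
  assumes "\<And>x. skew_on_length k (f x)"
  shows "skew_on_length (Suc k) (\<lambda>l. alternating_sum l f)"
  unfolding skew_on_length_def
proof (intro allI impI)
  fix us vs :: "'b list" and a b :: 'b
  assume "Suc (Suc (length us + length vs)) = Suc k"
  then show "alternating_sum (us @ b # a # vs) f = - alternating_sum (us @ a # b # vs) f"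
    using assms
  proof (induction us arbitrary: f k)
    case Nil
    have "alternating_sum vs (\<lambda>x l. f x (b # a # l)) = alternating_sum vs (\<lambda>x l. - f x (a # b # l))"
      by (rule alternating_sum_cong, rule skew_on_lengthD[OF Nil.prems(2), where us = "[]", simplified])
        (use Nil.prems(1) in simp)
    then show ?case by (simp add: alternating_sum_minus)
  next
    case (Cons u us)
    obtain k' where k: "k = Suc k'" using Cons.prems(1) by (cases k) auto
    have "alternating_sum (us @ b # a # vs) (\<lambda>y l. f y (u # l)) =
        - alternating_sum (us @ a # b # vs) (\<lambda>y l. f y (u # l))"
    proof (rule Cons.IH)
      show "Suc (Suc (length us + length vs)) = Suc k'" using Cons.prems(1) k by simp
      show "skew_on_length k' (\<lambda>l. f y (u # l))" for y
        by (rule skew_on_length_Cons) (use Cons.prems(2) k in simp)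
    qed
    moreover have "f u (us @ b # a # vs) = - f u (us @ a # b # vs)"
      by (rule skew_on_lengthD[OF Cons.prems(2)]) (use Cons.prems(1) in simp)
    ultimately show ?case by simp
  qed
qed

text \<open>Bringing the changed entry to the front costs exactly the sign of its position.\<close>

lemma derivation_sum_skew:
  assumes "skew_on_length (length xs) f"
  shows "derivation_sum c xs f = alternating_sum xs (\<lambda>x l. f (c x # l))"
  using assms
proof (induction xs arbitrary: f)
  case (Cons x xs)
  have "derivation_sum c xs (\<lambda>l. f (x # l)) = alternating_sum xs (\<lambda>y l. f (x # c y # l))"
    by (rule Cons.IH, rule skew_on_length_Cons) (use Cons.prems in simp)
  also have "\<dots> = alternating_sum xs (\<lambda>y l. - f (c y # x # l))"
    by (rule alternating_sum_cong, rule skew_on_lengthD[OF Cons.prems, where us = "[]", simplified])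
      simp
  finally show ?case by (simp add: alternating_sum_minus)
qed simp

lemma skew_symmetric_in_adjacent:
  assumes "skew_symmetric_in {p..<q} n f" "p \<le> length us" "length us + 2 \<le> q"
    "length us + 2 + length vs = n"
  shows "f (us @ b # a # vs) = - f (us @ a # b # vs)"
proof -
  let ?xs = "us @ a # b # vs" and ?i = "length us"
  have "f (?xs[?i := ?xs ! Suc ?i, Suc ?i := ?xs ! ?i]) = - f ?xs"
    by (rule assms(1)[unfolded skew_symmetric_in_def, rule_format]) (use assms in auto)
  moreover have "?xs ! Suc ?i = b" "?xs ! ?i = a" by (simp_all add: nth_append)
  moreover have "?xs[?i := b, Suc ?i := a] = us @ b # a # vs" by (simp add: list_update_append)
  ultimately show ?thesis by metis
qed

lemma skew_symmetric_in_append: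
  fixes f :: "'a list \<Rightarrow> 'a::ab_group_add"
  assumes "skew_symmetric_in {p..<q} n f" "length us = p" "q + length vs = n" "q = p + k"
  shows "skew_on_length k (\<lambda>l. f (us @ l @ vs))"
  unfolding skew_on_length_def
proof (intro allI impI)
  fix as bs :: "'a list" and a b
  assume "Suc (Suc (length as + length bs)) = k"
  then show "f (us @ (as @ b # a # bs) @ vs) = - f (us @ (as @ a # b # bs) @ vs)"
    using skew_symmetric_in_adjacent[OF assms(1), of "us @ as" "bs @ vs" b a] assms(2-) by simp
qed

text \<open>Moving the entry before \<open>ms\<close> across it makes the two entries adjacent. The
  cost is the same before and after the exchange, so only one adjacent swap counts.\<close>

lemma skew_on_length_transposition:
  assumes "skew_on_length k f" "length xs = k" "i < j" "j < k"
  shows "f (xs[i := xs ! j, j := xs ! i]) = - f xs"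
proof -
  define us ms vs where "us = take i xs" and "ms = take (j - Suc i) (drop (Suc i) xs)"
    and "vs = drop (Suc j) xs"
  define a b where "a = xs ! i" and "b = xs ! j"
  have l: "length us = i" "length ms = j - Suc i" using assms by (auto simp: us_def ms_def)
  have "drop (Suc i) xs = ms @ drop (j - Suc i) (drop (Suc i) xs)"
    unfolding ms_def by (rule append_take_drop_id[symmetric])
  also have "drop (j - Suc i) (drop (Suc i) xs) = b # vs"
    using assms by (simp add: b_def vs_def Cons_nth_drop_Suc)
  finally have xs: "xs = us @ a # ms @ b # vs"
    using assms id_take_nth_drop[of i xs] by (simp add: us_def a_def)
  have "xs[i := b, j := a] = us @ b # ms @ a # vs"
  proof -
    have "j - i = Suc (length ms)" using l assms(3) by simp
    then show ?thesis using l assms(3) by (subst xs) (simp add: list_update_append)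
  qed
  moreover have "f (us @ b # ms @ a # vs) = - f (us @ a # ms @ b # vs)"
  proof -
    have len: "length us + length ms + length vs + 2 = k" using assms(2) xs by simp
    have "f (us @ b # ms @ (a # vs)) = (if even (length ms) then f (us @ ms @ b # a # vs)
        else - f (us @ ms @ b # a # vs))"
      by (rule skew_move[OF assms(1)]) (use len in simp)
    moreover have "f (us @ a # ms @ (b # vs)) = (if even (length ms) then f (us @ ms @ a # b # vs)
        else - f (us @ ms @ a # b # vs))"
      by (rule skew_move[OF assms(1)]) (use len in simp)
    moreover have "f ((us @ ms) @ b # a # vs) = - f ((us @ ms) @ a # b # vs)"
      by (rule skew_on_lengthD[OF assms(1)]) (use len in simp)
    ultimately show ?thesis by simp
  qed
  ultimately have "f (xs[i := b, j := a]) = - f xs" using xs by metis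
  then show ?thesis unfolding a_def b_def .
qed

lemma skew_symmetric_inI:
  assumes "\<And>z. skew_on_length k (\<lambda>l. f (l @ [z]))"
  shows "skew_symmetric_in {0..<k} (Suc k) f"
  unfolding skew_symmetric_in_def
proof (intro allI impI)
  fix xs :: "'a list" and i j
  assume *: "length xs = Suc k" "i \<in> {0..<k}" "j \<in> {0..<k}" "i \<noteq> j"
  obtain ys z where xs: "xs = ys @ [z]" using *(1) by (cases xs rule: rev_cases) auto
  have l: "length ys = k" using * xs by simp
  have "f (ys[i := ys ! j, j := ys ! i] @ [z]) = - f (ys @ [z])" if "i < j" "j < k" for i j
    using skew_on_length_transposition[OF assms l that] .
  from this[of i j] this[of j i]
  have "f (ys[i := ys ! j, j := ys ! i] @ [z]) = - f (ys @ [z])"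
    using * by (cases "i < j") (auto simp: list_update_swap)
  then show "f (xs[i := xs ! j, j := xs ! i]) = - f xs"
    using * l xs by (simp add: list_update_append nth_append)
qed

section \<open>From recursive alternating sums to indexed signed sums\<close>

lemma omit_Cons: "1 \<le> i \<Longrightarrow> omit (Suc i) (x # xs) = x # omit i xs"
  by (cases i) (auto simp: omit_def)

context vector_space
begin

lemma alternating_sum_eq_sum:
  "alternating_sum xs f = (\<Sum>i=1..length xs. scale ((-1) ^ (i + 1)) (f (xs ! (i - 1)) (omit i xs)))"
proof (induction xs arbitrary: f)
  case (Cons x xs)
  let ?t = "\<lambda>i. scale ((-1) ^ (i + 1)) (f ((x # xs) ! (i - 1)) (omit i (x # xs)))"
  have "(\<Sum>i=1..length (x # xs). ?t i) = ?t 1 + (\<Sum>i=Suc 1..Suc (length xs). ?t i)"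
    by (subst sum.atLeast_Suc_atMost) simp_all
  also have "?t 1 = f x xs" by (simp add: omit_def)
  also have "(\<Sum>i=Suc 1..Suc (length xs). ?t i)
      = - (\<Sum>i=1..length xs. scale ((-1) ^ (i + 1)) (f (xs ! (i - 1)) (x # omit i xs)))"
    unfolding sum.shift_bounds_cl_Suc_ivl sum_negf[symmetric]
    by (intro sum.cong refl) (auto simp: omit_Cons nth_Cons split: nat.splits)
  finally show ?case by (simp only: alternating_sum.simps Cons.IH diff_conv_add_uminus)
qed simp

lemma alternating_sum_scale:
  "alternating_sum xs (\<lambda>x l. scale c (f x l)) = scale c (alternating_sum xs f)"
  by (induction xs arbitrary: f) (simp_all add: scale_right_diff_distrib)

end

section \<open>Functions on the vertices of an odd graph\<close>

text \<open>
  A vertex of the odd graph is represented by the complement of the usual one: the vertices are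
  the \<open>k\<close>-subsets of a set \<open>U\<close> with \<open>2 k - 1\<close> elements, and \<open>S\<close>, \<open>T\<close> are adjacent if they meet in
  exactly one point. The eigenvalues of the adjacency operator are \<open>k, -(k - 1), k - 2, \<dots>\<close>; what
  matters below is that \<open>0\<close> is never one of them, and \<open>-1\<close> is not one of them if \<open>k\<close> is odd.
\<close>

definition odd_graph_sum :: "'v set \<Rightarrow> ('v set \<Rightarrow> 'a::ab_group_add) \<Rightarrow> 'v set \<Rightarrow> 'a" where
  "odd_graph_sum U G S = (\<Sum>m\<in>S. G (insert m (U - S)))"

text \<open>Groups the vertices by the number of points shared with \<open>S\<close>, that is, by
  their distance from \<open>S\<close> in the graph. On these layers the adjacency operator acts by
  a matrix with two nonzero entries per row.\<close>

definition layer_sum ::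
    "'v set \<Rightarrow> nat \<Rightarrow> 'v set \<Rightarrow> ('v set \<Rightarrow> 'a::ab_group_add) \<Rightarrow> nat \<Rightarrow> 'a" where
  "layer_sum U k S G j = (\<Sum>T | T \<subseteq> U \<and> card T = k \<and> card (T \<inter> S) = j. G T)"

locale char_0_vector_space = vector_space scale
  for scale :: "'k::field_char_0 \<Rightarrow> 'a::ab_group_add \<Rightarrow> 'a" (infixr \<open>*s\<close> 75)
begin

text \<open>The layers form an equitable partition and the coefficients are its quotient matrix: a
  vertex \<open>W\<close> with l points in \<open>S\<close> has l neighbours with k + 1 - l points
  in \<open>S\<close> and k - l neighbours with k - l points in \<open>S\<close>.\<close>

lemma layer_sum_odd_graph_sum:
  assumes U: "finite U" "card U = 2 * k - 1" and k: "k \<ge> 1"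
    and S: "S \<subseteq> U" "card S = k" and j: "j \<le> k"
  shows "layer_sum U k S (odd_graph_sum U G) j =
    of_nat (Suc k - j) *s layer_sum U k S G (Suc k - j) + of_nat j *s layer_sum U k S G (k - j)"
proof -
  define V where "V = {T. T \<subseteq> U \<and> card T = k}"
  define c where "c W u = card (insert u (U - W) \<inter> S)" for W u
  have subU: "x \<in> U" if "x \<in> T" "T \<in> V" for x T using that by (auto simp: V_def)
  have finV: "finite V" using U by (simp add: V_def)
  have fin: "finite T" if "T \<in> V" for T using that U by (auto simp: V_def intro: finite_subset)
  have inV: "insert m (U - T) \<in> V" if "T \<in> V" "m \<in> T" for T m
  proof -
    have T: "T \<subseteq> U" "card T = k" using that(1) by (simp_all add: V_def)
    have "card (U - T) = card U - card T" by (rule card_Diff_subset[OF fin[OF that(1)] T(1)])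
    then have "card (insert m (U - T)) = k" using U k T that(2) by simp
    then show ?thesis using T that(2) by (auto simp: V_def)
  qed
  have inv: "insert m (U - insert m (U - T)) = T" if "T \<in> V" "m \<in> T" for T m
    using that by (auto simp: V_def)
  have layer: "layer_sum U k S H i = (\<Sum>W\<in>V. if card (W \<inter> S) = i then H W else 0)"
    for H :: "'b set \<Rightarrow> 'a" and i
  proof -
    have "{T. T \<subseteq> U \<and> card T = k \<and> card (T \<inter> S) = i} = {T \<in> V. card (T \<inter> S) = i}"
      by (auto simp: V_def)
    then show ?thesis unfolding layer_sum_def using finV by (simp add: sum.inter_filter)
  qed
  have cnt: "card {u \<in> W. c W u = j} = (if card (W \<inter> S) = Suc k - j then Suc k - j else 0)
      + (if card (W \<inter> S) = k - j then j else 0)" if W: "W \<in> V" for W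
  proof -
    define l where "l = card (W \<inter> S)"
    have finS: "finite S" using S U finite_subset by blast
    have lk: "l \<le> k" unfolding l_def using card_mono[OF finS, of "W \<inter> S"] S by simp
    have "(U - W) \<inter> S = S - W \<inter> S" using S by auto
    then have d: "card ((U - W) \<inter> S) = k - l"
      using finS S by (simp add: card_Diff_subset l_def)
    have cS: "c W u = (if u \<in> S then Suc (k - l) else k - l)" if "u \<in> W" for u
    proof (cases "u \<in> S")
      case True
      then have "insert u (U - W) \<inter> S = insert u ((U - W) \<inter> S)" by auto
      then show ?thesis using that d finS True by (simp add: c_def)
    qed (simp add: c_def d)
    have WS: "card (W - S) = k - l"
      using W fin[OF W] card_Diff_subset_Int[of W S] by (simp add: V_def l_def)
    have "{u \<in> W. c W u = j} = (if Suc (k - l) = j then W \<inter> S else {}) \<union>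
        (if k - l = j then W - S else {})"
      using cS by (auto split: if_splits)
    also have "card \<dots> = (if Suc (k - l) = j then l else 0) + (if k - l = j then k - l else 0)"
      using WS by (auto simp: l_def)
    also have "\<dots> = (if l = Suc k - j then Suc k - j else 0) + (if l = k - j then j else 0)"
      using lk j by auto
    finally show ?thesis by (simp add: l_def)
  qed
  have "layer_sum U k S (odd_graph_sum U G) j
      = (\<Sum>T\<in>V. \<Sum>m\<in>T. if card (T \<inter> S) = j then G (insert m (U - T)) else 0)"
    unfolding layer odd_graph_sum_def by (intro sum.cong refl) auto
  also have "\<dots> = (\<Sum>(T, m)\<in>Sigma V (\<lambda>T. T). if card (T \<inter> S) = j then G (insert m (U - T)) else 0)"
    using finV fin by (subst sum.Sigma) auto
  \<comment> \<open>Counts the edges from their other end: for fixed \<open>m\<close>, taking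
    \<open>T\<close> to \<open>insert m (U - T)\<close> is an involution on the vertices containing
    \<open>m\<close>.\<close>
  also have "\<dots> = (\<Sum>(W, u)\<in>Sigma V (\<lambda>T. T). if c W u = j then G W else 0)"
    by (rule sum.reindex_bij_witness[where i = "\<lambda>(T, m). (insert m (U - T), m)"
          and j = "\<lambda>(T, m). (insert m (U - T), m)"]) (auto simp: inV inv c_def dest: subU)
  also have "\<dots> = (\<Sum>W\<in>V. \<Sum>u\<in>W. if c W u = j then G W else 0)"
    using finV fin by (subst sum.Sigma) auto
  also have "\<dots> = (\<Sum>W\<in>V. of_nat (card {u \<in> W. c W u = j}) *s G W)"
    using fin by (intro sum.cong refl)
      (simp add: sum.inter_filter[symmetric] sum_constant_scale)
  also have "\<dots> = (\<Sum>W\<in>V. of_nat (Suc k - j) *s (if card (W \<inter> S) = Suc k - j then G W else 0)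
      + of_nat j *s (if card (W \<inter> S) = k - j then G W else 0))"
    by (intro sum.cong refl, subst cnt) (simp_all add: scale_left_distrib)
  finally show ?thesis unfolding layer by (simp add: sum.distrib scale_sum_right)
qed

text \<open>The layer is empty, because two disjoint vertices would need 2 k points.\<close>

lemma odd_graph_sum_layer_0:
  assumes "finite U" "card U = 2 * k - 1" "k \<ge> 1" "S \<subseteq> U" "card S = k"
  shows "layer_sum U k S G 0 = 0"
proof -
  have "card (T \<inter> S) \<noteq> 0" if "T \<subseteq> U" "card T = k" for T
  proof
    assume "card (T \<inter> S) = 0"
    moreover have "finite T" "finite S" using that assms finite_subset by blast+
    ultimately have "card (T \<union> S) = 2 * k" using that assms by (simp add: card_Un_disjoint)
    moreover have "card (T \<union> S) \<le> card U" using that assms by (intro card_mono) auto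
    ultimately show False using assms by linarith
  qed
  then have "{T. T \<subseteq> U \<and> card T = k \<and> card (T \<inter> S) = 0} = {}" by blast
  then show ?thesis unfolding layer_sum_def by (simp only: sum.empty)
qed

lemma layer_sum_top:
  assumes "finite U" "S \<subseteq> U" "card S = k"
  shows "layer_sum U k S G k = G S"
proof -
  have "{T. T \<subseteq> U \<and> card T = k \<and> card (T \<inter> S) = k} = {S}"
  proof (intro equalityI subsetI, goal_cases)
    case (1 T)
    have "finite T" "finite S" using 1 assms finite_subset by blast+
    then have "T \<inter> S = T" "T \<inter> S = S"
      using 1 assms by (metis (mono_tags, lifting) card_subset_eq inf_le1 mem_Collect_eq,
          metis (mono_tags, lifting) card_subset_eq inf_le2 mem_Collect_eq)
    then show ?case by simp
  qed (use assms in auto)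
  then show ?thesis unfolding layer_sum_def by simp
qed

text \<open>On the layer sums f the equation is the two-term recurrence (i + 1) f(i + 1) + (k - i)
  f(i) = 0, which starts at f(0) = 0 and ends at f(k) = \<open>G S\<close>.\<close>

lemma odd_graph_sum_eq_0:
  fixes G :: "'v set \<Rightarrow> 'a"
  assumes U: "finite U" "card U = 2 * k - 1" and k: "k \<ge> 1"
    and G: "\<And>T. T \<subseteq> U \<Longrightarrow> card T = k \<Longrightarrow> odd_graph_sum U G T = 0"
    and S: "S \<subseteq> U" "card S = k"
  shows "G S = 0"
proof -
  let ?f = "layer_sum U k S G"
  have "?f i = 0" if "i \<le> k" for i
    using that
  proof (induction i)
    case 0
    show ?case by (rule odd_graph_sum_layer_0[OF U k S])
  next
    case (Suc i)
    have "0 = layer_sum U k S (odd_graph_sum U G) (k - i)"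
      unfolding layer_sum_def by (rule sym, rule sum.neutral) (auto simp: G)
    also have "\<dots> = of_nat (Suc k - (k - i)) *s ?f (Suc k - (k - i)) + of_nat (k - i) *s ?f (k - (k - i))"
      by (rule layer_sum_odd_graph_sum[OF U k S]) simp
    also have "Suc k - (k - i) = Suc i" using Suc.prems by simp
    finally have "of_nat (Suc i) *s ?f (Suc i) = 0" using Suc by simp
    then show ?case by (simp only: scale_eq_0_iff of_nat_eq_0_iff) simp
  qed
  then show ?thesis using layer_sum_top[OF U(1) S, of G] by simp
qed

text \<open>On the layer sums f the equation reads f(j) + (k + 1 - j) f(k + 1 - j) + j f(k - j) = 0.
  It forces f(k + 1 - j) = - f(j). For odd \<open>k\<close> this reflection fixes the middle layer,
  which therefore vanishes, and a two-term recurrence carries the zero up to f(k) =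
  \<open>G S\<close>.\<close>

lemma odd_graph_sum_eq_minus:
  fixes G :: "'v set \<Rightarrow> 'a"
  assumes U: "finite U" "card U = 2 * k - 1" and k: "odd k"
    and G: "\<And>T. T \<subseteq> U \<Longrightarrow> card T = k \<Longrightarrow> odd_graph_sum U G T = - G T"
    and S: "S \<subseteq> U" "card S = k"
  shows "G S = 0"
proof -
  let ?f = "layer_sum U k S G"
  have k1: "k \<ge> 1" using k by (cases k) auto
  have rel: "?f j + of_nat (Suc k - j) *s ?f (Suc k - j) + of_nat j *s ?f (k - j) = 0"
    if "j \<le> k" for j
  proof -
    have "layer_sum U k S (odd_graph_sum U G) j = - ?f j"
      unfolding layer_sum_def sum_negf[symmetric] by (rule sum.cong) (auto simp: G)
    then show ?thesis using layer_sum_odd_graph_sum[OF U k1 S that, of G]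
      by (simp add: algebra_simps)
  qed
  \<comment> \<open>What is left of the relation at k + 1 - j after splitting off
    \<open>?f (Suc k - j) + ?f j\<close>. That sum is symmetric under the reflection, hence so is
    \<open>e\<close>; and \<open>e j = 0\<close> is the recurrence between neighbouring
    layers.\<close>
  define e where "e j = of_nat (Suc k - j) *s ?f (j - 1) + of_nat (j - 1) *s ?f j" for j
  have e1: "?f (Suc k - j) + ?f j + e j = 0" if "1 \<le> j" "j \<le> k" for j
  proof -
    have *: "Suc k - (Suc k - j) = j" "k - (Suc k - j) = j - 1" "Suc k - j \<le> k" using that by auto
    have "of_nat j *s ?f j = ?f j + of_nat (j - 1) *s ?f j"
      using that by (cases j) (simp_all add: scale_left_distrib)
    then show ?thesis using rel[OF *(3)] unfolding * e_def by (simp add: algebra_simps)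
  qed
  have e2: "e (Suc k - j) = e j" if "1 \<le> j" "j \<le> k" for j
  proof -
    have *: "Suc k - (Suc k - j) = j" "1 \<le> Suc k - j" "Suc k - j \<le> k" using that by auto
    show ?thesis using e1[OF that] e1[OF *(2,3)] unfolding *
      by (metis add.commute add_left_cancel)
  qed
  have e: "e j = 0" if "1 \<le> j" "j \<le> k" for j
    using that
  proof (induction j rule: dec_induct)
    case base
    show ?case by (simp add: e_def odd_graph_sum_layer_0[OF U k1 S])
  next
    case (step j)
    then have ej: "e j = 0" "e (Suc k - j) = 0" using e2[of j] by auto
    have *: "Suc k - (Suc k - j) = j" "Suc k - j - 1 = k - j" using step by auto
    have "of_nat j *s ?f (k - j) = - (of_nat (k - j) *s ?f (Suc k - j))"
      using ej(2) unfolding e_def * by (simp add: eq_neg_iff_add_eq_0)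
    also have "?f (Suc k - j) = - ?f j"
      using e1[of j] ej step by (simp add: eq_neg_iff_add_eq_0)
    finally have "of_nat (k - j) *s ?f j = of_nat j *s ?f (k - j)" by simp
    \<comment> \<open>\<open>e (Suc j)\<close> turns out to be -j times itself, and j + 1 is
      invertible.\<close>
    then have "e (Suc j) = of_nat j *s (?f (k - j) + ?f (Suc j))"
      by (simp add: e_def scale_right_distrib)
    also have "?f (k - j) + ?f (Suc j) = - e (Suc j)"
      using e1[of "Suc j"] step by (simp add: eq_neg_iff_add_eq_0)
    finally have "of_nat (Suc j) *s e (Suc j) = 0"
      by (simp add: scale_left_distrib eq_neg_iff_add_eq_0)
    then show ?case by (simp only: scale_eq_0_iff of_nat_eq_0_iff) simp
  qed
  obtain p where p: "k = 2 * p + 1" using k by (elim oddE)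
  have "?f i = 0" if "Suc p \<le> i" "i \<le> k" for i
    using that
  proof (induction i rule: dec_induct)
    case base
    have "Suc k - Suc p = Suc p" using p by simp
    then have "?f (Suc p) + ?f (Suc p) = 0" using e1[of "Suc p"] e[of "Suc p"] p by simp
    then have "(2::'k) *s ?f (Suc p) = 0" by (metis scale_left_distrib scale_one one_add_one)
    then show ?case by simp
  next
    case (step i)
    have "of_nat i *s ?f (Suc i) = 0" using e[of "Suc i"] step by (simp add: e_def)
    then show ?case using step by simp
  qed
  then show ?thesis using layer_sum_top[OF U(1) S, of G] p by simp
qed

text \<open>Excluding the eigenvalue -1 gives \<A>^2 G = 0; injectivity of \<A> then applies
  twice.\<close>

lemma odd_graph_sum_iterate_eq_0:
  fixes G :: "'v set \<Rightarrow> 'a"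
  assumes U: "finite U" "card U = 2 * k - 1" and k: "odd k"
    and G: "\<And>T. T \<subseteq> U \<Longrightarrow> card T = k \<Longrightarrow>
      odd_graph_sum U (odd_graph_sum U (odd_graph_sum U G)) T = - odd_graph_sum U (odd_graph_sum U G) T"
    and S: "S \<subseteq> U" "card S = k"
  shows "G S = 0"
proof -
  have k1: "k \<ge> 1" using k by (cases k) auto
  have "odd_graph_sum U (odd_graph_sum U G) T = 0" if "T \<subseteq> U" "card T = k" for T
    by (rule odd_graph_sum_eq_minus[OF U k G that])
  then have "odd_graph_sum U G T = 0" if "T \<subseteq> U" "card T = k" for T
    using odd_graph_sum_eq_0[OF U k1 _ that] by blast
  then show ?thesis using odd_graph_sum_eq_0[OF U k1 _ S] by blast
qed

end

section \<open>The sign of a list of natural numbers\<close>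

text \<open>The parity of the number of inversions; the value 0 on lists with a repeated entry makes
  skew-symmetry hold for all lists.\<close>

primrec list_sign :: "nat list \<Rightarrow> 'k::comm_ring_1" where
  "list_sign [] = 1"
| "list_sign (a # xs) =
     prod_list (map (\<lambda>b. if a < b then 1 else if b < a then - 1 else 0) xs) * list_sign xs"

lemma skew_on_length_list_sign: "skew_on_length k (list_sign :: nat list \<Rightarrow> 'k::comm_ring_1)"
proof -
  have prod: "prod_list (map g (us @ b # a # vs)) = prod_list (map g (us @ a # b # vs))"
    for g :: "nat \<Rightarrow> 'k" and us a b vs by (simp add: ac_simps)
  have "(list_sign (us @ b # a # vs) :: 'k) = - list_sign (us @ a # b # vs)" for us a b vs
  proof (induction us)
    case Nil
    show ?case by (cases a b rule: linorder_cases) (simp_all add: ac_simps)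
  next
    case (Cons u us)
    then show ?case by (simp only: append_Cons list_sign.simps prod) simp
  qed
  then show ?thesis unfolding skew_on_length_def by blast
qed

lemma list_sign_square: "distinct xs \<Longrightarrow> list_sign xs * list_sign xs = 1"
proof (induction xs)
  case (Cons a xs)
  let ?p = "prod_list (map (\<lambda>b. if a < b then 1 else if b < a then - 1 else 0) xs) :: 'a"
  have "?p * ?p = 1" using Cons.prems
    by (induction xs) (auto simp: algebra_simps)
  then have "(?p * ?p) * (list_sign xs * list_sign xs) = 1" using Cons by simp
  then show ?case by (simp add: ac_simps)
qed simp

text \<open>Insertion sort consists of adjacent swaps. The prefix \<open>us\<close> is carried along
  because the hypothesis speaks of the whole list.\<close>

lemma swap_invariant_sorted_list_of_set:
  assumes "\<And>us a b vs. set (us @ a # b # vs) = set xs \<Longrightarrow> distinct (us @ a # b # vs) \<Longrightarrow>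
      f (us @ b # a # vs) = f (us @ a # b # vs)"
    and "distinct xs"
  shows "f xs = f (sorted_list_of_set (set xs) :: nat list)"
proof -
  have ins: "f (us @ a # ys) = f (us @ insort a ys)"
    if "set (us @ a # ys) = set xs" "distinct (us @ a # ys)" for us a ys
    using that
  proof (induction ys arbitrary: us)
    case (Cons y ys)
    show ?case
    proof (cases "a \<le> y")
      case False
      have "f (us @ a # y # ys) = f ((us @ [y]) @ a # ys)"
        using assms(1)[of us a y ys] Cons.prems by simp
      also have "\<dots> = f ((us @ [y]) @ insort a ys)"
        by (rule Cons.IH) (use Cons.prems in auto)
      finally show ?thesis using False by simp
    qed simp
  qed simp
  have "f (us @ ys) = f (us @ sort ys)"
    if "set (us @ ys) = set xs" "distinct (us @ ys)" for us ys
    using that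
  proof (induction ys arbitrary: us)
    case (Cons y ys)
    have "f ((us @ [y]) @ ys) = f ((us @ [y]) @ sort ys)"
      by (rule Cons.IH) (use Cons.prems in auto)
    also have "\<dots> = f (us @ insort y (sort ys))"
      using ins[of us y "sort ys"] Cons.prems by simp
    finally show ?case by simp
  qed simp
  from this[of "[]" xs] show ?thesis
    using assms(2) by (simp add: sorted_list_of_set_sort_remdups distinct_remdups_id)
qed

section \<open>Exchanging entries between two skew-symmetric blocks\<close>

definition biskew :: "nat \<Rightarrow> ('b list \<Rightarrow> 'b list \<Rightarrow> 'a::ab_group_add) \<Rightarrow> bool" where
  "biskew j H \<longleftrightarrow>
     (\<forall>N. length N = j \<longrightarrow> skew_on_length (Suc j) (\<lambda>M. H M N)) \<and>
     (\<forall>M. length M = Suc j \<longrightarrow> skew_on_length j (H M))"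

text \<open>The adjacency operator of the odd graph on lists: \<open>M\<close> is a vertex,
  \<open>N\<close> its complement, and the neighbour consists of \<open>N\<close> and one entry
  \<open>m\<close> of \<open>M\<close>.\<close>

definition exchange :: "('b list \<Rightarrow> 'b list \<Rightarrow> 'a::ab_group_add) \<Rightarrow> 'b list \<Rightarrow> 'b list \<Rightarrow> 'a" where
  "exchange H M N = alternating_sum M (\<lambda>m l. H (N @ [m]) l)"

lemma skew_on_length_snoc:
  fixes f :: "'a list \<Rightarrow> 'b::ab_group_add"
  assumes "skew_on_length (Suc k) f"
  shows "skew_on_length k (\<lambda>l. f (l @ [x]))"
  unfolding skew_on_length_def
proof (intro allI impI)
  fix us vs :: "'a list" and a b
  assume "Suc (Suc (length us + length vs)) = k"
  then show "f ((us @ b # a # vs) @ [x]) = - f ((us @ a # b # vs) @ [x])"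
    using skew_on_lengthD[OF assms, of us "vs @ [x]" b a] by simp
qed

lemma skew_on_length_alternating_sum_param:
  fixes f :: "'b \<Rightarrow> 'b list \<Rightarrow> 'c list \<Rightarrow> 'a::ab_group_add"
  assumes "\<And>x l. Suc (length l) = length xs \<Longrightarrow> skew_on_length k (f x l)"
  shows "skew_on_length k (\<lambda>N. alternating_sum xs (\<lambda>x l. f x l N))"
  unfolding skew_on_length_def
proof (intro allI impI)
  fix us vs :: "'c list" and a b
  assume k: "Suc (Suc (length us + length vs)) = k"
  have "alternating_sum xs (\<lambda>x l. f x l (us @ b # a # vs)) =
      alternating_sum xs (\<lambda>x l. - f x l (us @ a # b # vs))"
    by (rule alternating_sum_cong, rule skew_on_lengthD[OF assms k])
  then show "alternating_sum xs (\<lambda>x l. f x l (us @ b # a # vs)) =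
      - alternating_sum xs (\<lambda>x l. f x l (us @ a # b # vs))"
    by (simp add: alternating_sum_minus)
qed

lemma biskew_exchange:
  assumes "biskew j H"
  shows "biskew j (exchange H)"
  unfolding biskew_def exchange_def
proof (intro conjI allI impI)
  fix N :: "'a list" assume "length N = j"
  then show "skew_on_length (Suc j) (\<lambda>M. alternating_sum M (\<lambda>m. H (N @ [m])))"
    using assms by (intro skew_on_length_alternating_sum) (simp add: biskew_def)
next
  fix M :: "'a list" assume "length M = Suc j"
  then show "skew_on_length j (\<lambda>N. alternating_sum M (\<lambda>m. H (N @ [m])))"
    using assms
    by (intro skew_on_length_alternating_sum_param skew_on_length_snoc) (simp add: biskew_def)
qed

lemma exchange_cong:
  assumes "\<And>M N. length M = Suc j \<Longrightarrow> length N = j \<Longrightarrow> G M N = H M N"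
    and "length M = Suc j" "length N = j"
  shows "exchange G M N = exchange H M N"
  unfolding exchange_def by (rule alternating_sum_cong) (simp add: assms)

lemma exchange_add: "exchange (\<lambda>M N. G M N + H M N) = (\<lambda>M N. exchange G M N + exchange H M N)"
  by (simp add: exchange_def alternating_sum_add fun_eq_iff)

context char_0_vector_space
begin

text \<open>\<open>S\<close> and \<open>U\<close> consist of positions, which \<open>x\<close> maps
  to the possibly equal letters. The sign makes the value independent of how the two blocks are
  arranged and turns the alternating sum in \<open>exchange\<close> into an unsigned one.\<close>

definition signed_value ::
    "(nat \<Rightarrow> 'c) \<Rightarrow> nat set \<Rightarrow> ('c list \<Rightarrow> 'c list \<Rightarrow> 'a) \<Rightarrow> nat set \<Rightarrow> 'a" where
  "signed_value x U H S =
     (*s) (list_sign (sorted_list_of_set S @ sorted_list_of_set (U - S)))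
       (H (map x (sorted_list_of_set S)) (map x (sorted_list_of_set (U - S))))"

text \<open>An adjacent swap inside either block flips both factors, so both blocks can be sorted
  without changing the product.\<close>

lemma signed_value_eq:
  assumes H: "biskew j H" and d: "distinct (P @ Q)" and l: "length P = Suc j" "length Q = j"
  shows "(*s) (list_sign (P @ Q)) (H (map x P) (map x Q)) = signed_value x (set P \<union> set Q) H (set P)"
proof -
  let ?P = "sorted_list_of_set (set P)" and ?Q = "sorted_list_of_set (set Q)"
  have len: "length ps = card (set qs)" if "set ps = set qs" "distinct ps" for ps qs :: "nat list"
    using that distinct_card by metis
  have lP: "length ?P = Suc j" using d l by (simp add: distinct_card)
  have "(*s) (list_sign (P @ Q)) (H (map x P) (map x Q)) =
      (*s) (list_sign (?P @ Q)) (H (map x ?P) (map x Q))"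
  proof (rule swap_invariant_sorted_list_of_set)
    fix us a b vs
    assume "set (us @ a # b # vs) = set P" "distinct (us @ a # b # vs)"
    then have "length (us @ a # b # vs) = Suc j" using len d l by (metis distinct_append distinct_card)
    then have "list_sign (us @ b # a # vs @ Q) = - (list_sign (us @ a # b # vs @ Q) :: 'k)"
      and "H (map x us @ x b # x a # map x vs) (map x Q) = - H (map x us @ x a # x b # map x vs) (map x Q)"
      using H l by (auto simp: biskew_def
          intro!: skew_on_lengthD[OF skew_on_length_list_sign] skew_on_lengthD[where k = "Suc j" and f = "\<lambda>M. H M (map x Q)"])
    then show "(*s) (list_sign ((us @ b # a # vs) @ Q)) (H (map x (us @ b # a # vs)) (map x Q)) =
        (*s) (list_sign ((us @ a # b # vs) @ Q)) (H (map x (us @ a # b # vs)) (map x Q))"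
      by simp
  qed (use d in simp)
  also have "\<dots> = (*s) (list_sign (?P @ ?Q)) (H (map x ?P) (map x ?Q))"
  proof (rule swap_invariant_sorted_list_of_set)
    fix us a b vs
    assume "set (us @ a # b # vs) = set Q" "distinct (us @ a # b # vs)"
    then have "length (us @ a # b # vs) = j" using len d l by (metis distinct_append distinct_card)
    then have "list_sign ((?P @ us) @ b # a # vs) = - (list_sign ((?P @ us) @ a # b # vs) :: 'k)"
      and "H (map x ?P) (map x us @ x b # x a # map x vs) = - H (map x ?P) (map x us @ x a # x b # map x vs)"
      using H lP by (auto simp: biskew_def simp del: append_assoc
          intro!: skew_on_lengthD[OF skew_on_length_list_sign] skew_on_lengthD[where k = j and f = "H (map x ?P)"])
    then show "(*s) (list_sign (?P @ us @ b # a # vs)) (H (map x ?P) (map x (us @ b # a # vs))) =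
        (*s) (list_sign (?P @ us @ a # b # vs)) (H (map x ?P) (map x (us @ a # b # vs)))"
      by simp
  qed (use d in simp)
  also have "set Q = set P \<union> set Q - set P" using d by auto
  finally show ?thesis by (simp add: signed_value_def)
qed

text \<open>The sign of \<open>m\<close> in the alternating sum is the cost of moving
  \<open>m\<close> to the front of \<open>M\<close>, and moving \<open>N\<close> before the j + 1
  entries of \<open>M\<close> takes j (j + 1) swaps, an even number. So each term carries the sign
  that belongs to its vertex.\<close>

lemma signed_value_exchange:
  assumes j: "even j" and H: "biskew j H" and U: "finite U" "card U = 2 * Suc j - 1"
    and S: "S \<subseteq> U" "card S = Suc j"
  shows "signed_value x U (exchange H) S = odd_graph_sum U (signed_value x U H) S"
proof -
  define M N where "M = sorted_list_of_set S" and "N = sorted_list_of_set (U - S)"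
  have finS: "finite S" using S U finite_subset by blast
  have set: "set M = S" "set N = U - S" and d: "distinct M" "distinct N"
    using finS U by (simp_all add: M_def N_def)
  have l: "length M = Suc j" "length N = j"
    using S U finS d set by (simp_all add: M_def N_def card_Diff_subset)
  define s where "s = (list_sign (M @ N) :: 'k)"
  have "signed_value x U (exchange H) S =
      alternating_sum M (\<lambda>m l. (*s) s (H (map x (N @ [m])) (map x l)))"
    by (simp add: signed_value_def exchange_def alternating_sum_map alternating_sum_scale
        M_def N_def s_def)
  also have "\<dots> = (\<Sum>m\<in>set M. signed_value x U H (insert m (U - S)))"
  proof (rule alternating_sum_eq_sum_set[OF d(1)])
    fix us m vs assume M: "M = us @ m # vs"
    have lu: "length us + length vs = j" using M l by simp
    have "(list_sign (us @ m # vs @ N) :: 'k) =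
        (if even (length us) then list_sign (m # us @ vs @ N) else - list_sign (m # us @ vs @ N))"
      using skew_block_move[OF skew_on_length_list_sign, of "[]" us "[m]" "vs @ N", OF refl]
      by (cases "even (length us)") (simp_all del: list_sign.simps(2))
    moreover have "(list_sign (m # us @ vs @ N) :: 'k) = list_sign (N @ m # us @ vs)"
      using skew_block_move[OF skew_on_length_list_sign, of "[]" "m # us @ vs" N "[]", OF refl] l j lu
      by (simp del: list_sign.simps(2))
    ultimately have s: "s = (if even (length us) then list_sign (N @ m # us @ vs)
        else - list_sign (N @ m # us @ vs))"
      by (simp add: s_def M)
    have "(*s) (list_sign ((N @ [m]) @ us @ vs)) (H (map x (N @ [m])) (map x (us @ vs))) =
        signed_value x (set (N @ [m]) \<union> set (us @ vs)) H (set (N @ [m]))"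
      using d set M l lu by (intro signed_value_eq[OF H]) auto
    also have "set (N @ [m]) \<union> set (us @ vs) = U" using set M S by auto
    also have "set (N @ [m]) = insert m (U - S)" using set by auto
    finally show "(*s) s (H (map x (N @ [m])) (map x (us @ vs))) =
        (if even (length us) then signed_value x U H (insert m (U - S))
         else - signed_value x U H (insert m (U - S)))"
      by (simp add: s)
  qed
  finally show ?thesis by (simp add: odd_graph_sum_def set)
qed

end

lemma odd_graph_sum_cong:
  assumes "finite U" "card U = 2 * k - 1" "S \<subseteq> U" "card S = k"
    and "\<And>T. T \<subseteq> U \<Longrightarrow> card T = k \<Longrightarrow> G T = H T"
  shows "odd_graph_sum U G S = odd_graph_sum U H S"
  unfolding odd_graph_sum_def
proof (rule sum.cong[OF refl])
  fix m assume m: "m \<in> S"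
  have fin: "finite S" using assms finite_subset by blast
  then have "card S > 0" using m card_gt_0_iff by blast
  then have "card (insert m (U - S)) = k"
    using assms(1-4) m fin by (simp add: card_Diff_subset)
  then show "G (insert m (U - S)) = H (insert m (U - S))" using assms m by auto
qed

text \<open>With the letters labelled by positions, \<open>M\<close> is the vertex
  \<open>{..<Suc j}\<close>, of odd size. The signed value vanishes there, and the sign of a
  distinct list is not 0.\<close>

lemma (in char_0_vector_space) exchange_iterate_eq_0:
  fixes G :: "'b list \<Rightarrow> 'b list \<Rightarrow> 'a"
  assumes j: "even j" and G: "biskew j G"
    and eq: "\<And>M N. length M = Suc j \<Longrightarrow> length N = j \<Longrightarrow>
      exchange (exchange (exchange G)) M N = - exchange (exchange G) M N"
    and l: "length M = Suc j" "length N = j"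
  shows "G M N = 0"
proof -
  define U where "U = {..<length (M @ N)}"
  define x where "x i = (M @ N) ! i" for i
  let ?s = "signed_value x U"
  have U: "finite U" "card U = 2 * Suc j - 1" using l by (simp_all add: U_def)
  have G2: "biskew j (exchange G)" "biskew j (exchange (exchange G))"
    using G by (simp_all add: biskew_exchange)
  note ex = signed_value_exchange[OF j _ U, where x = x]
  have ex2: "?s (exchange (exchange G)) T = odd_graph_sum U (odd_graph_sum U (?s G)) T"
    if "T \<subseteq> U" "card T = Suc j" for T
    using odd_graph_sum_cong[OF U that ex[OF G]] ex[OF G2(1) that] by simp
  have ex3: "?s (exchange (exchange (exchange G))) T =
      odd_graph_sum U (odd_graph_sum U (odd_graph_sum U (?s G))) T"
    if "T \<subseteq> U" "card T = Suc j" for T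
    using odd_graph_sum_cong[OF U that ex2] ex[OF G2(2) that] by simp
  have "?s G {..<Suc j} = 0"
  proof (rule odd_graph_sum_iterate_eq_0[OF U])
    show "odd (Suc j)" using j by simp
    fix T assume T: "T \<subseteq> U" "card T = Suc j"
    then have "finite T" using U finite_subset by blast
    then have "length (sorted_list_of_set T) = Suc j" "length (sorted_list_of_set (U - T)) = j"
      using T U by (simp_all add: card_Diff_subset)
    then have "?s (exchange (exchange (exchange G))) T = - ?s (exchange (exchange G)) T"
      by (simp add: signed_value_def eq)
    then show "odd_graph_sum U (odd_graph_sum U (odd_graph_sum U (?s G))) T =
        - odd_graph_sum U (odd_graph_sum U (?s G)) T"
      using ex2 ex3 T by simp
  qed (use l in \<open>auto simp: U_def\<close>)
  moreover have "list_sign ([0..<Suc j] @ [Suc j..<2 * j + 1]) *s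
      G (map x [0..<Suc j]) (map x [Suc j..<2 * j + 1])
      = signed_value x (set [0..<Suc j] \<union> set [Suc j..<2 * j + 1]) G (set [0..<Suc j])"
    by (rule signed_value_eq[OF G]) (auto simp del: upt_Suc)
  moreover have "set [0..<Suc j] \<union> set [Suc j..<2 * j + 1] = U"
    using l by (auto simp: U_def simp del: upt_Suc)
  moreover have "map x [0..<Suc j] = M" "map x [Suc j..<2 * j + 1] = N"
    using l by (auto simp: x_def nth_append intro!: nth_equalityI simp del: upt_Suc)
  moreover have "set [0..<Suc j] = {..<Suc j}" by auto
  ultimately have "list_sign ([0..<Suc j] @ [Suc j..<2 * j + 1]) *s G M N = 0" by simp
  moreover have "distinct ([0..<Suc j] @ [Suc j..<2 * j + 1])" by auto
  from list_sign_square[OF this, where ?'a = 'k]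
  have "list_sign ([0..<Suc j] @ [Suc j..<2 * j + 1]) \<noteq> (0 :: 'k)" by (metis mult_zero_left zero_neq_one)
  ultimately show ?thesis using scale_eq_0_iff by blast
qed

section \<open>The associated brackets as alternating sums\<close>

text \<open>Returning an extracted entry to its place costs the sign that the alternating sum gives
  it, so every term equals \<open>f xs\<close>. The multiple is written as a repeated sum because
  only an abelian group is assumed.\<close>

lemma alternating_sum_skew_const:
  assumes "skew_on_length (length xs) f"
  shows "alternating_sum xs (\<lambda>x l. f (x # l)) = (\<Sum>i<length xs. f xs)"
  using assms
proof (induction xs arbitrary: f)
  case (Cons x xs)
  have "alternating_sum xs (\<lambda>y l. f (y # x # l)) = alternating_sum xs (\<lambda>y l. - f (x # y # l))"
    by (rule alternating_sum_cong, rule skew_on_lengthD[OF Cons.prems, where us = "[]", simplified])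
      simp
  also have "alternating_sum xs (\<lambda>y l. f (x # y # l)) = (\<Sum>i<length xs. f (x # xs))"
    by (rule Cons.IH, rule skew_on_length_Cons) (use Cons.prems in simp)
  ultimately show ?case by (simp add: alternating_sum_minus add.commute)
qed simp

lemma skew_on_length_add:
  fixes f g :: "'b list \<Rightarrow> 'a::ab_group_add"
  assumes "skew_on_length k f" "skew_on_length k g"
  shows "skew_on_length k (\<lambda>l. f l + g l)"
  unfolding skew_on_length_def
proof (intro allI impI)
  fix us vs :: "'b list" and a b
  assume "Suc (Suc (length us + length vs)) = k"
  note skew_on_lengthD[OF assms(1) this, of b a] skew_on_lengthD[OF assms(2) this, of b a]
  then show "f (us @ b # a # vs) + g (us @ b # a # vs) = - (f (us @ a # b # vs) + g (us @ a # b # vs))"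
    by simp
qed

lemma skew_on_length_diff:
  fixes f g :: "'b list \<Rightarrow> 'a::ab_group_add"
  assumes "skew_on_length k f" "skew_on_length k g"
  shows "skew_on_length k (\<lambda>l. f l - g l)"
  unfolding skew_on_length_def
proof (intro allI impI)
  fix us vs :: "'b list" and a b
  assume "Suc (Suc (length us + length vs)) = k"
  note skew_on_lengthD[OF assms(1) this, of b a] skew_on_lengthD[OF assms(2) this, of b a]
  then show "f (us @ b # a # vs) - g (us @ b # a # vs) = - (f (us @ a # b # vs) - g (us @ a # b # vs))"
    by simp
qed

lemma skew_on_length_cong:
  assumes "\<And>l. length l = k \<Longrightarrow> f l = g l"
  shows "skew_on_length k f \<longleftrightarrow> skew_on_length k g"
  unfolding skew_on_length_def by (simp add: assms)

section \<open>Linearity of alternating sums, and the brackets as alternating sums\<close>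

context vector_space
begin

lemma linear_map_add:
  "Vector_Spaces.linear scale scale f \<Longrightarrow> Vector_Spaces.linear scale scale g \<Longrightarrow>
    Vector_Spaces.linear scale scale (\<lambda>z. f z + g z)"
  by (simp add: Vector_Spaces.linear_iff scale_right_distrib)

lemma linear_map_diff:
  "Vector_Spaces.linear scale scale f \<Longrightarrow> Vector_Spaces.linear scale scale g \<Longrightarrow>
    Vector_Spaces.linear scale scale (\<lambda>z. f z - g z)"
  by (simp add: Vector_Spaces.linear_iff scale_right_diff_distrib)

lemma linear_map_zero: "Vector_Spaces.linear scale scale (\<lambda>z. 0)"
  by (simp add: Vector_Spaces.linear_iff vector_space_axioms)

lemma linear_map_alternating_sum:
  assumes "\<And>x l. Suc (length l) = length xs \<Longrightarrow> Vector_Spaces.linear scale scale (f x l)"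
  shows "Vector_Spaces.linear scale scale (\<lambda>z. alternating_sum xs (\<lambda>x l. f x l z))"
  using assms
proof (induction xs arbitrary: f)
  case Nil
  show ?case by (simp add: linear_map_zero)
next
  case (Cons y xs)
  then show ?case by (simp add: linear_map_diff)
qed

text \<open>The varying entry is either extracted or among the entries left behind, hence the two
  assumptions.\<close>

lemma linear_map_alternating_sum_entry:
  assumes "\<And>l. length l = length us + length vs \<Longrightarrow> Vector_Spaces.linear scale scale (\<lambda>z. f z l)"
    and "\<And>x as bs. Suc (length as + length bs) = length us + length vs \<Longrightarrow>
      Vector_Spaces.linear scale scale (\<lambda>z. f x (as @ z # bs))"
  shows "Vector_Spaces.linear scale scale (\<lambda>z. alternating_sum (us @ z # vs) f)"
  using assms
proof (induction us arbitrary: f)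
  case Nil
  have "Vector_Spaces.linear scale scale (\<lambda>z. alternating_sum vs (\<lambda>x l. f x (z # l)))"
    by (rule linear_map_alternating_sum, rule Nil.prems(2)[of "[]", simplified]) simp
  then show ?case using Nil.prems(1)[of vs] by (simp add: linear_map_diff)
next
  case (Cons u us)
  have "Vector_Spaces.linear scale scale
      (\<lambda>z. alternating_sum (us @ z # vs) (\<lambda>y l. f y (u # l)))"
  proof (rule Cons.IH)
    show "Vector_Spaces.linear scale scale (\<lambda>z. f z (u # l))"
      if "length l = length us + length vs" for l
      by (rule Cons.prems(1)) (use that in simp)
    show "Vector_Spaces.linear scale scale (\<lambda>z. f x (u # as @ z # bs))"
      if "Suc (length as + length bs) = length us + length vs" for x as bs
      using Cons.prems(2)[of "u # as" bs x] that by simp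
  qed
  moreover have "Vector_Spaces.linear scale scale (\<lambda>z. f u (us @ z # vs))"
    by (rule Cons.prems(2)) simp
  ultimately show ?case by (simp add: linear_map_diff)
qed

lemma multilinear_iff:
  "multilinear scale n f \<longleftrightarrow> (\<forall>us vs. Suc (length us + length vs) = n \<longrightarrow>
     Vector_Spaces.linear scale scale (\<lambda>z. f (us @ z # vs)))"
proof (intro iffI allI impI)
  fix us vs :: "'b list" assume "multilinear scale n f" "Suc (length us + length vs) = n"
  then have "Vector_Spaces.linear scale scale (\<lambda>z. f ((us @ 0 # vs)[length us := z]))"
    unfolding multilinear_def by (metis length_append length_Cons add_Suc_right less_add_Suc1)
  then show "Vector_Spaces.linear scale scale (\<lambda>z. f (us @ z # vs))"
    by simp
next
  assume *: "\<forall>us vs. Suc (length us + length vs) = n \<longrightarrow>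
     Vector_Spaces.linear scale scale (\<lambda>z. f (us @ z # vs))"
  show "multilinear scale n f"
    unfolding multilinear_def
  proof (intro allI impI)
    fix xs :: "'b list" and i assume "length xs = n" "i < n"
    then show "Vector_Spaces.linear scale scale (\<lambda>z. f (xs[i := z]))"
      using *[rule_format, of "take i xs" "drop (Suc i) xs"]
      by (simp add: upd_conv_take_nth_drop)
  qed
qed

lemma linear_map_apply_alternating_sum:
  assumes "Vector_Spaces.linear scale scale F"
  shows "F (alternating_sum xs f) = alternating_sum xs (\<lambda>x l. F (f x l))"
  by (rule additive_alternating_sum) (use assms in \<open>simp add: Vector_Spaces.linear_iff\<close>)

lemma signed_sum_eq_alternating_sum:
  assumes "length xs = n"
  shows "(\<Sum>i=1..n. scale ((-1) ^ (n - i)) (f (xs ! (i - 1)) (omit i xs))) =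
    scale ((-1) ^ Suc n) (alternating_sum xs f)"
proof -
  have "(-1) ^ (n - i) = (-1) ^ Suc n * ((-1) ^ (i + 1) :: 'a)" if "i \<in> {1..n}" for i
    using that by (auto simp: minus_one_power_iff)
  then show ?thesis
    unfolding alternating_sum_eq_sum assms scale_sum_right
    by (intro sum.cong refl) (simp del: power_Suc)
qed

lemma n_commutator_eq:
  "length xs = n \<Longrightarrow>
    n_commutator scale n br xs = scale ((-1) ^ Suc n) (alternating_sum xs (\<lambda>x l. br (l @ [x])))"
  unfolding n_commutator_def
  by (rule signed_sum_eq_alternating_sum[where f = "\<lambda>x l. br (l @ [x])"])

lemma horizontal_bracket_eq:
  assumes "Suc (length ys) = n"
  shows "horizontal_bracket scale n nw ne (ys @ [z]) =
    nw (ys @ [z]) + alternating_sum ys (\<lambda>x l. ne (x # l @ [z]))"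
proof -
  have "n - 1 = length ys" using assms by simp
  then show ?thesis
    unfolding horizontal_bracket_def alternating_sum_eq_sum
    by (intro arg_cong2[of _ _ _ _ "(+)"] sum.cong refl) (auto simp: omit_append nth_append)
qed

lemma vertical_bracket_eq:
  assumes "Suc (length ys) = n"
  shows "vertical_bracket scale n nw ne (ys @ [z]) =
    nw (ys @ [z]) - alternating_sum ys (\<lambda>x l. ne (z # l @ [x]))"
proof -
  have "n - 1 = length ys" using assms by simp
  then show ?thesis
    unfolding vertical_bracket_def alternating_sum_eq_sum diff_conv_add_uminus sum_negf[symmetric]
    by (intro arg_cong2[of _ _ _ _ "(+)"] sum.cong refl) (auto simp: nth_append)
qed

end

context n_L_dendriform_algebra
begin

sublocale char_0_vector_space scale ..

section \<open>Linearity and skew-symmetry of the operations and of both brackets\<close>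

lemma nw_linear: "Suc (length us + length vs) = n \<Longrightarrow>
    Vector_Spaces.linear scale scale (\<lambda>z. nw (us @ z # vs))"
  using nw_multilinear unfolding multilinear_iff by blast

lemma ne_linear: "Suc (length us + length vs) = n \<Longrightarrow>
    Vector_Spaces.linear scale scale (\<lambda>z. ne (us @ z # vs))"
  using ne_multilinear unfolding multilinear_iff by blast

lemma nw_skew_block: "Suc k = n \<Longrightarrow> skew_on_length k (\<lambda>l. nw (l @ [z]))"
  using skew_symmetric_in_append[where us = "[]" and p = 0 and vs = "[z]", of "n - 1" n nw k] nw_skew
  by auto

lemma ne_skew_block: "Suc (Suc k) = n \<Longrightarrow> skew_on_length k (\<lambda>l. ne (a # l @ [z]))"
  using skew_symmetric_in_append[where us = "[a]" and p = 1 and vs = "[z]", of "n - 1" n ne k] ne_skew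
  by auto

lemma h_eq: "Suc (length ys) = n \<Longrightarrow>
    h (ys @ [z]) = nw (ys @ [z]) + alternating_sum ys (\<lambda>x l. ne (x # l @ [z]))"
  unfolding h_def by (rule horizontal_bracket_eq)

lemma v_eq: "Suc (length ys) = n \<Longrightarrow>
    v (ys @ [z]) = nw (ys @ [z]) - alternating_sum ys (\<lambda>x l. ne (z # l @ [x]))"
  unfolding v_def by (rule vertical_bracket_eq)

lemma h_skew_block:
  assumes "Suc k = n"
  shows "skew_on_length k (\<lambda>l. h (l @ [z]))"
proof -
  obtain j where k: "k = Suc j" using assms n_ge_2 by (cases k) auto
  have "skew_on_length k (\<lambda>l. nw (l @ [z]) + alternating_sum l (\<lambda>x l. ne (x # l @ [z])))"
    unfolding k using assms k
    by (intro skew_on_length_add nw_skew_block skew_on_length_alternating_sum ne_skew_block) auto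
  then show ?thesis using assms by (subst skew_on_length_cong[OF h_eq]) auto
qed

lemma v_skew_block:
  assumes "Suc k = n"
  shows "skew_on_length k (\<lambda>l. v (l @ [z]))"
proof -
  obtain j where k: "k = Suc j" using assms n_ge_2 by (cases k) auto
  have "skew_on_length k (\<lambda>l. nw (l @ [z]) - alternating_sum l (\<lambda>x l. ne (z # l @ [x])))"
    unfolding k using assms k
    by (intro skew_on_length_diff nw_skew_block skew_on_length_alternating_sum ne_skew_block) auto
  then show ?thesis using assms by (subst skew_on_length_cong[OF v_eq]) auto
qed

lemma h_multilinear: "multilinear scale n h"
  unfolding multilinear_iff
proof (intro allI impI)
  fix us vs :: "'a list" assume n: "Suc (length us + length vs) = n"
  show "Vector_Spaces.linear scale scale (\<lambda>z. h (us @ z # vs))"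
  proof (cases vs rule: rev_cases)
    case Nil
    have "Vector_Spaces.linear scale scale
        (\<lambda>z. nw (us @ [z]) + alternating_sum us (\<lambda>x l. ne (x # l @ [z])))"
      using n Nil nw_linear[of us "[]"] ne_linear[of "_ # _" "[]"]
      by (intro linear_map_add linear_map_alternating_sum) auto
    then show ?thesis using n Nil by (simp add: h_eq)
  next
    case (snoc ws b)
    have "Vector_Spaces.linear scale scale (\<lambda>z. nw ((us @ z # ws) @ [b]) +
        alternating_sum (us @ z # ws) (\<lambda>x l. ne (x # l @ [b])))"
      using n snoc nw_linear[of us vs] ne_linear[of "[]" "_ @ [b]"] ne_linear[of "_ # _" "_ @ [b]"]
      by (intro linear_map_add linear_map_alternating_sum_entry) auto
    then show ?thesis using n snoc h_eq[of "us @ _ # ws" b] by simp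
  qed
qed

lemma v_multilinear: "multilinear scale n v"
  unfolding multilinear_iff
proof (intro allI impI)
  fix us vs :: "'a list" assume n: "Suc (length us + length vs) = n"
  show "Vector_Spaces.linear scale scale (\<lambda>z. v (us @ z # vs))"
  proof (cases vs rule: rev_cases)
    case Nil
    have "Vector_Spaces.linear scale scale
        (\<lambda>z. nw (us @ [z]) - alternating_sum us (\<lambda>x l. ne (z # l @ [x])))"
      using n Nil nw_linear[of us "[]"] ne_linear[of "[]" "_ @ [_]"]
      by (intro linear_map_diff linear_map_alternating_sum) auto
    then show ?thesis using n Nil by (simp add: v_eq)
  next
    case (snoc ws b)
    have "Vector_Spaces.linear scale scale (\<lambda>z. nw ((us @ z # ws) @ [b]) -
        alternating_sum (us @ z # ws) (\<lambda>x l. ne (b # l @ [x])))"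
      using n snoc nw_linear[of us vs] ne_linear[of "b # _" "[]"] ne_linear[of "b # _" "_ @ [_]"]
      by (intro linear_map_diff linear_map_alternating_sum_entry) auto
    then show ?thesis using n snoc v_eq[of "us @ _ # ws" b] by simp
  qed
qed

lemma C_eq_h: "length xs = n \<Longrightarrow>
    C xs = (-1) ^ Suc n *s alternating_sum xs (\<lambda>x l. h (l @ [x]))"
  unfolding C_def by (rule n_commutator_eq)

lemma C_eq_v: "length xs = n \<Longrightarrow>
    C xs = (-1) ^ Suc n *s alternating_sum xs (\<lambda>x l. v (l @ [x]))"
  unfolding C_def h_def v_def
  by (subst n_commutator_horizontal_eq_vertical) (rule vector_space_axioms | simp add: n_commutator_eq)+

text \<open>The factor (-1)^(n + 1) of the commutator and the cost (-1)^(n - 2) of moving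
  \<open>y\<close> across \<open>l\<close> combine to -1; in the term with \<open>y\<close> last,
  the factor cancels the sign of position \<open>n\<close>. Hence no parity of \<open>n\<close> is
  left. Stating it for any bracket with commutator \<open>C\<close> covers both \<open>h\<close> and
  \<open>v\<close>.\<close>

lemma C_snoc:
  assumes br: "\<And>z k. Suc k = n \<Longrightarrow> skew_on_length k (\<lambda>l. br (l @ [z]))"
    and C: "\<And>xs. length xs = n \<Longrightarrow> C xs = (-1) ^ Suc n *s alternating_sum xs (\<lambda>x l. br (l @ [x]))"
    and xs: "Suc (length xs) = n"
  shows "C (xs @ [y]) = br (xs @ [y]) - alternating_sum xs (\<lambda>x l. br (y # l @ [x]))"
proof -
  have "alternating_sum xs (\<lambda>x l. br ((l @ [y]) @ [x])) =
      alternating_sum xs (\<lambda>x l. (-1) ^ n *s br ((y # l) @ [x]))"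
  proof (rule alternating_sum_cong)
    fix x :: 'a and l :: "'a list" assume l: "Suc (length l) = length xs"
    have "br (([] @ [y] @ l @ []) @ [x]) = (if even (length [y] * length l)
        then br (([] @ l @ [y] @ []) @ [x]) else - br (([] @ l @ [y] @ []) @ [x]))"
      by (rule skew_block_move[OF br]) (use l xs in auto)
    moreover have "n = Suc (Suc (length l))" using l xs by simp
    ultimately show "br ((l @ [y]) @ [x]) = (-1) ^ n *s br ((y # l) @ [x])"
      by (auto simp: minus_one_power_iff split: if_splits)
  qed
  then show ?thesis using C[of "xs @ [y]"] xs
    by (auto simp: alternating_sum_snoc alternating_sum_scale scale_right_distrib minus_one_power_iff)
qed

lemmas C_snoc_h = C_snoc[OF h_skew_block C_eq_h]
  and C_snoc_v = C_snoc[OF v_skew_block C_eq_v]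

section \<open>The axioms in terms of derivations and alternating sums\<close>

lemma D1_derivation:
  assumes "Suc (length xs) = n" "Suc (length ys) = n"
  shows "nw (xs @ [nw (ys @ [z])]) =
    nw (ys @ [nw (xs @ [z])]) + derivation_sum (\<lambda>y. C (xs @ [y])) ys (\<lambda>l. nw (l @ [z]))"
  using D1[of xs ys z] assms by (auto simp: derivation_sum_eq_sum algebra_simps)

lemma D2_alternating:
  assumes "length xs = n" "Suc (length ys) = n"
  shows "nw (C xs # ys) = (-1) ^ Suc n *s alternating_sum xs (\<lambda>x l. nw (l @ [nw (x # ys)]))"
  using D2[of xs ys] assms
    signed_sum_eq_alternating_sum[of xs n "\<lambda>x l. nw (l @ [nw (x # ys)])"] by auto

lemma D3_derivation:
  assumes "Suc (length xs) = n" "Suc (Suc (length ys)) = n"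
  shows "nw (xs @ [ne (a # ys @ [b])]) = ne (a # ys @ [h (xs @ [b])]) + ne (v (xs @ [a]) # ys @ [b])
    + derivation_sum (\<lambda>y. C (xs @ [y])) ys (\<lambda>l. ne (a # l @ [b]))"
proof -
  have "length ys = n - 2" using assms by simp
  then show ?thesis
    using D3[of xs ys a b] assms(1) by (auto simp: derivation_sum_eq_sum algebra_simps)
qed

lemma D4_alternating:
  assumes "length xs = n" "Suc (Suc (length ys)) = n"
  shows "ne (a # C xs # ys) = (-1) ^ Suc n *s alternating_sum xs (\<lambda>x l. nw (l @ [ne (a # x # ys)]))"
proof -
  have "length ys = n - 2" using assms by simp
  then show ?thesis
    using D4[of xs ys a] assms(1)
      signed_sum_eq_alternating_sum[of xs n "\<lambda>x l. nw (l @ [ne (a # x # ys)])"] by auto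
qed

lemma D5_alternating:
  assumes "Suc (Suc (length xs)) = n" "Suc (length ys) = n"
  shows "ne (a # xs @ [h (ys @ [z])]) - nw (ys @ [ne (a # xs @ [z])]) =
    alternating_sum ys (\<lambda>y l. ne (v (xs @ [y, a]) # l @ [z]))"
proof -
  have "length xs = n - 2" using assms by simp
  then show ?thesis
    using D5[of xs ys a z] assms(2) by (auto simp: alternating_sum_eq_sum)
qed

lemma D6_alternating:
  assumes "Suc (length xs) = n" "Suc (length ys) = n"
  shows "ne (v (xs @ [a]) # ys) =
    nw (xs @ [ne (a # ys)]) - alternating_sum xs (\<lambda>x l. ne (a # l @ [h (x # ys)]))"
proof -
  have "(\<Sum>i=1..n-1. (-1) ^ i *s ne (a # omit i xs @ [h (xs ! (i - 1) # ys)])) =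
      - alternating_sum xs (\<lambda>x l. ne (a # l @ [h (x # ys)]))"
    using assms by (auto simp: alternating_sum_eq_sum sum_negf[symmetric])
  then show ?thesis using D6[of xs ys a] assms by (auto simp: algebra_simps)
qed

end

section \<open>The pre-Lie identities\<close>

context n_L_dendriform_algebra
begin

lemma nw_last:
  assumes "Suc (length us) = n"
  shows nw_last_add: "nw (us @ [x + y]) = nw (us @ [x]) + nw (us @ [y])"
    and nw_last_diff: "nw (us @ [x - y]) = nw (us @ [x]) - nw (us @ [y])"
    and nw_last_alternating_sum:
      "nw (us @ [alternating_sum xs f]) = alternating_sum xs (\<lambda>x l. nw (us @ [f x l]))"
proof -
  have lin: "Vector_Spaces.linear scale scale (\<lambda>z. nw (us @ [z]))"
    using nw_linear[of us "[]"] assms by simp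
  then show add: "nw (us @ [x + y]) = nw (us @ [x]) + nw (us @ [y])" for x y
    by (simp add: Vector_Spaces.linear_iff)
  show "nw (us @ [x - y]) = nw (us @ [x]) - nw (us @ [y])"
    using add[of "x - y" y] by simp
  show "nw (us @ [alternating_sum xs f]) = alternating_sum xs (\<lambda>x l. nw (us @ [f x l]))"
    by (rule linear_map_apply_alternating_sum[OF lin])
qed

lemma ne_entry:
  assumes "Suc (length us + length vs) = n"
  shows ne_diff: "ne (us @ (x - y) # vs) = ne (us @ x # vs) - ne (us @ y # vs)"
    and ne_minus: "ne (us @ (- x) # vs) = - ne (us @ x # vs)"
    and ne_scale: "ne (us @ (c *s x) # vs) = c *s ne (us @ x # vs)"
    and ne_alternating_sum:
      "ne (us @ alternating_sum xs f # vs) = alternating_sum xs (\<lambda>x l. ne (us @ f x l # vs))"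
proof -
  note lin = ne_linear[OF assms]
  have add: "ne (us @ (x + y) # vs) = ne (us @ x # vs) + ne (us @ y # vs)" for x y
    using lin by (simp add: Vector_Spaces.linear_iff)
  show diff: "ne (us @ (x - y) # vs) = ne (us @ x # vs) - ne (us @ y # vs)" for x y
    using add[of "x - y" y] by simp
  show "ne (us @ (- x) # vs) = - ne (us @ x # vs)"
    using diff[of 0 x] diff[of 0 0] by simp
  show "ne (us @ (c *s x) # vs) = c *s ne (us @ x # vs)"
    using lin by (simp add: Vector_Spaces.linear_iff)
  show "ne (us @ alternating_sum xs f # vs) = alternating_sum xs (\<lambda>x l. ne (us @ f x l # vs))"
    by (rule linear_map_apply_alternating_sum[OF lin])
qed

text \<open>
  For even \<open>n\<close>, \<open>D5\<close> carries the sign opposite to the one that the pre-Lie identities ask for.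
  This does no harm: with \<open>\<A>\<close> for \<open>exchange\<close>, the axioms \<open>D5\<close>, \<open>D6\<close> and \<open>D3\<close> (with \<open>D4\<close>) read
  \<open>E - W = \<A> G\<close>, \<open>G - W = - \<A> E\<close> and \<open>W - E = G + (\<A>\<^sup>2 - 1) W\<close>, hence
  \<open>(\<A> + 1) \<A>\<^sup>2 G = 0\<close>, which forces \<open>G = 0\<close>.
\<close>

lemma even_ne_v_eq_0:
  assumes even: "even n" and l: "Suc (length M) = n" "Suc (Suc (length N)) = n"
  shows "ne (v (M @ [a]) # N @ [z]) = 0"
proof -
  obtain j where n: "n = Suc (Suc j)" using n_ge_2 by (metis Suc_le_D numeral_2_eq_2 Suc_le_mono)
  have j: "even j" using even n by simp
  define G where "G M N = ne (v (M @ [a]) # N @ [z])" for M N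
  define W where "W M N = nw (M @ [ne (a # N @ [z])])" for M N
  define E where "E M N = ne (a # N @ [h (M @ [z])])" for M N
  have "biskew j G"
    unfolding biskew_def
  proof (intro conjI allI impI)
    fix N :: "'a list" assume N: "length N = j"
    show "skew_on_length (Suc j) (\<lambda>M. G M N)"
      unfolding skew_on_length_def
    proof (intro allI impI)
      fix us vs :: "'a list" and b c
      assume "Suc (Suc (length us + length vs)) = Suc j"
      then have "v ((us @ c # b # vs) @ [a]) = - v ((us @ b # c # vs) @ [a])"
        using skew_on_lengthD[OF v_skew_block, of "Suc j" us vs c b a] n by simp
      then show "G (us @ c # b # vs) N = - G (us @ b # c # vs) N"
        using ne_minus[of "[]" "N @ [z]"] N n by (simp add: G_def)
    qed
  next
    fix M :: "'a list"
    show "skew_on_length j (G M)" unfolding G_def using ne_skew_block n by blast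
  qed
  have D5: "E M N = W M N + exchange G M N" if "length M = Suc j" "length N = j" for M N
    using D5_alternating[of N M a z] that n by (simp add: E_def W_def G_def exchange_def algebra_simps)
  have D6: "G M N = W M N - exchange E M N" if "length M = Suc j" "length N = j" for M N
  proof -
    have "alternating_sum M (\<lambda>x l. ne (a # l @ [h (x # N @ [z])])) = exchange E M N"
      unfolding exchange_def
    proof (rule alternating_sum_cong)
      fix x l
      \<comment> \<open>\<open>D6\<close> has \<open>x\<close> in front of \<open>N\<close> and
        \<open>exchange\<close> has it behind; the two agree because \<open>N\<close> has even
        length.\<close>
      have "h (([] @ [x] @ N @ []) @ [z]) = (if even (length [x] * length N)
          then h (([] @ N @ [x] @ []) @ [z]) else - h (([] @ N @ [x] @ []) @ [z]))"
        by (rule skew_block_move[OF h_skew_block]) (use that n in auto)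
      then show "ne (a # l @ [h (x # N @ [z])]) = E (N @ [x]) l"
        using that j by (simp add: E_def)
    qed
    then show ?thesis using D6_alternating[of M "N @ [z]" a] that n by (simp add: G_def W_def)
  qed
  have W_skew: "skew_on_length (Suc j) (\<lambda>M. W M N)" for N
    unfolding W_def using nw_skew_block n by blast
  have W_skew': "skew_on_length j (W M)" if M: "length M = Suc j" for M
    unfolding skew_on_length_def
  proof (intro allI impI)
    fix us vs :: "'a list" and b c
    assume "Suc (Suc (length us + length vs)) = j"
    then have "ne (a # (us @ c # b # vs) @ [z]) = - ne (a # (us @ b # c # vs) @ [z])"
      using skew_on_lengthD[OF ne_skew_block, of j us vs a c b z] n by simp
    then show "W M (us @ c # b # vs) = - W M (us @ b # c # vs)"
      using nw_last_diff[of M 0] nw_last_diff[of M 0 0] M n by (simp add: W_def)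
  qed
  \<comment> \<open>The derivation term of \<open>D3\<close>, rewritten by \<open>D4\<close>, is j
    times \<open>W M N\<close> minus \<open>?X\<close>, and the double exchange of \<open>W\<close>
    is j + 1 times \<open>W M N\<close> minus the same \<open>?X\<close>. So they differ by
    \<open>W M N\<close>.\<close>
  have D3: "W M N + W M N = E M N + G M N + exchange (exchange W) M N"
    if l: "length M = Suc j" "length N = j" for M N
  proof -
    let ?X = "alternating_sum M (\<lambda>m l. alternating_sum N (\<lambda>p r. W (l @ [p]) (m # r)))"
    have "derivation_sum (\<lambda>y. C (M @ [y])) N (\<lambda>l. ne (a # l @ [z])) =
        alternating_sum N (\<lambda>q l. ne (a # C (M @ [q]) # l @ [z]))"
      using derivation_sum_skew[OF ne_skew_block] l n by simp
    also have "\<dots> = alternating_sum N (\<lambda>q l. W M (q # l)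
        - alternating_sum M (\<lambda>m r. W (r @ [q]) (m # l)))"
      by (rule alternating_sum_cong, subst D4_alternating)
        (use l n j in \<open>auto simp: alternating_sum_snoc W_def\<close>)
    also have "\<dots> = (\<Sum>i<j. W M N) - ?X"
      using alternating_sum_skew_const[of N "W M"] W_skew'[OF l(1)] l(2)
      by (simp add: alternating_sum_diff alternating_sum_commute[of N M])
    finally have der: "derivation_sum (\<lambda>y. C (M @ [y])) N (\<lambda>l. ne (a # l @ [z])) =
        (\<Sum>i<j. W M N) - ?X" .
    have "exchange (exchange W) M N = alternating_sum M (\<lambda>m l.
        alternating_sum N (\<lambda>p r. W (l @ [p]) (r @ [m])) + W (l @ [m]) N)"
      using l j by (simp add: exchange_def alternating_sum_snoc)
    also have "\<dots> = alternating_sum M (\<lambda>m l.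
        alternating_sum N (\<lambda>p r. - W (l @ [p]) (m # r)) + W (m # l) N)"
    proof (rule alternating_sum_cong)
      fix m and l' :: "'a list" assume l': "Suc (length l') = length M"
      have "alternating_sum N (\<lambda>p r. W (l' @ [p]) (r @ [m])) =
          alternating_sum N (\<lambda>p r. - W (l' @ [p]) (m # r))"
      proof (rule alternating_sum_cong)
        fix p and r :: "'a list" assume r: "Suc (length r) = length N"
        have "W (l' @ [p]) ([] @ [m] @ r @ []) = (if even (length [m] * length r)
            then W (l' @ [p]) ([] @ r @ [m] @ []) else - W (l' @ [p]) ([] @ r @ [m] @ []))"
          by (rule skew_block_move[OF W_skew']) (use l l' r in auto)
        moreover have "odd (length r)" using r l j by (metis even_Suc)
        ultimately show "W (l' @ [p]) (r @ [m]) = - W (l' @ [p]) (m # r)" by simp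
      qed
      moreover have "W ([] @ [m] @ l' @ []) N = (if even (length [m] * length l')
          then W ([] @ l' @ [m] @ []) N else - W ([] @ l' @ [m] @ []) N)"
        by (rule skew_block_move[OF W_skew]) (use l l' in auto)
      ultimately show "alternating_sum N (\<lambda>p r. W (l' @ [p]) (r @ [m])) + W (l' @ [m]) N =
          alternating_sum N (\<lambda>p r. - W (l' @ [p]) (m # r)) + W (m # l') N"
        using l l' j by simp
    qed
    also have "\<dots> = (\<Sum>i<Suc j. W M N) - ?X"
      using alternating_sum_skew_const[of M "\<lambda>M. W M N"] W_skew l(1)
      by (simp add: alternating_sum_add alternating_sum_minus alternating_sum_diff)
    finally have "exchange (exchange W) M N = W M N + (\<Sum>i<j. W M N) - ?X"
      by (simp add: add.commute)
    moreover have "W M N = E M N + G M N +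
        derivation_sum (\<lambda>y. C (M @ [y])) N (\<lambda>l. ne (a # l @ [z]))"
      unfolding W_def E_def G_def by (rule D3_derivation) (use l n in auto)
    moreover have "w + w = e + g + q" if "q = w + s - x" "w = e + g + (s - x)" for w e g q s x :: 'a
      unfolding that(1) using arg_cong[OF that(2), of "(+) w"] by (simp add: algebra_simps)
    ultimately show ?thesis unfolding der by blast
  qed
  \<comment> \<open>Elimination of \<open>E\<close> and \<open>W\<close>: \<open>D5\<close> and
    \<open>D6\<close> give W = G + \<A> W + \<A>^2 G, while \<open>D3\<close> and \<open>D5\<close>
    give W = G + \<A> G + \<A>^2 W. Applying \<A> to the former and comparing leaves \<A>^2 G +
    \<A>^3 G = 0.\<close>
  have eq: "exchange (exchange (exchange G)) M N = - exchange (exchange G) M N"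
    if l: "length M = Suc j" "length N = j" for M N
  proof -
    have W1: "W M N = G M N + (exchange W M N + exchange (exchange G) M N)"
      if l: "length M = Suc j" "length N = j" for M N
      using exchange_cong[OF D5 l] D6[OF l] by (simp add: exchange_add)
    have "exchange W M N =
        exchange G M N + (exchange (exchange W) M N + exchange (exchange (exchange G)) M N)"
      using exchange_cong[OF W1 l] by (simp add: exchange_add)
    then have "exchange (exchange G) M N + exchange (exchange (exchange G)) M N = 0"
      using W1[OF l] D3[OF l] D5[OF l] by (simp add: algebra_simps)
    then show ?thesis by (simp only: eq_neg_iff_add_eq_0 add.commute)
  qed
  have "G M N = 0"
    by (rule exchange_iterate_eq_0[OF j \<open>biskew j G\<close>], erule (1) eq) (use l n in simp_all)
  then show ?thesis by (simp only: G_def)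
qed

text \<open>For odd \<open>n\<close>, moving \<open>y\<close> across the n - 2 entries of
  \<open>xs\<close> produces the sign; for even \<open>n\<close>, both sides of the termwise
  identity vanish by \<open>even_ne_v_eq_0\<close>.\<close>

lemma D5_corrected:
  assumes l: "Suc (Suc (length xs)) = n" "Suc (length ys) = n"
  shows "ne (a # xs @ [h (ys @ [z])]) =
    nw (ys @ [ne (a # xs @ [z])]) - alternating_sum ys (\<lambda>y l. ne (v (y # xs @ [a]) # l @ [z]))"
proof -
  have "alternating_sum ys (\<lambda>y l. ne (v (xs @ [y, a]) # l @ [z])) =
      alternating_sum ys (\<lambda>y l. - ne (v (y # xs @ [a]) # l @ [z]))"
  proof (rule alternating_sum_cong)
    fix y and l' :: "'a list" assume l': "Suc (length l') = length ys"
    show "ne (v (xs @ [y, a]) # l' @ [z]) = - ne (v (y # xs @ [a]) # l' @ [z])"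
    proof (cases "even n")
      case True
      then show ?thesis
        using even_ne_v_eq_0[of "xs @ [y]" l' a z] even_ne_v_eq_0[of "y # xs" l' a z] l l' by simp
    next
      case False
      have "v (([] @ [y] @ xs @ []) @ [a]) = (if even (length [y] * length xs)
          then v (([] @ xs @ [y] @ []) @ [a]) else - v (([] @ xs @ [y] @ []) @ [a]))"
        by (rule skew_block_move[OF v_skew_block]) (use l in auto)
      moreover have "odd (length xs)" using False l by (metis even_Suc)
      ultimately have "v (y # xs @ [a]) = - v (xs @ [y, a])" by simp
      then show ?thesis using ne_minus[of "[]" "l' @ [z]"] l l' by simp
    qed
  qed
  then show ?thesis using D5_alternating[of xs ys a z] l
    by (simp add: alternating_sum_minus algebra_simps)
qed

text \<open>\<open>D3\<close> yields the derivation of \<nearrow> except where the commutator lands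
  in its first slot. There \<open>D3\<close> and \<open>D5_corrected\<close> each supply one half of
  \<open>C_snoc_v\<close>, and their remaining terms make up \<open>h (Y @ [h (X @ [z])])\<close>
  together with those of \<open>D1\<close>.\<close>

lemma h_h:
  assumes l: "Suc (length X) = n" "Suc (length Y) = n"
  shows "h (X @ [h (Y @ [z])]) =
    derivation_sum (\<lambda>y. C (X @ [y])) Y (\<lambda>l. h (l @ [z])) + h (Y @ [h (X @ [z])])"
proof -
  let ?c = "\<lambda>y. C (X @ [y])"
  have nwh: "nw (X @ [h (Y @ [z])]) =
      nw (X @ [nw (Y @ [z])]) + alternating_sum Y (\<lambda>y l. nw (X @ [ne (y # l @ [z])]))"
    if "Suc (length X) = n" "Suc (length Y) = n" for X Y
    using that by (simp add: h_eq nw_last)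
  have A2: "alternating_sum Y (\<lambda>y l. nw (X @ [ne (y # l @ [z])])) =
      alternating_sum Y (\<lambda>y l. ne (y # l @ [h (X @ [z])]))
      + alternating_sum Y (\<lambda>y l. ne (v (X @ [y]) # l @ [z]))
      + alternating_sum Y (\<lambda>y l. derivation_sum ?c l (\<lambda>l. ne (y # l @ [z])))"
    unfolding alternating_sum_add[symmetric]
    by (rule alternating_sum_cong, rule D3_derivation) (use l in auto)
  have A3: "alternating_sum X (\<lambda>x l. ne (x # l @ [h (Y @ [z])])) =
      alternating_sum X (\<lambda>x l. nw (Y @ [ne (x # l @ [z])]))
      - alternating_sum X (\<lambda>x l. alternating_sum Y (\<lambda>y r. ne (v (y # l @ [x]) # r @ [z])))"
    unfolding alternating_sum_diff[symmetric]
    by (rule alternating_sum_cong, rule D5_corrected) (use l in auto)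
  have "derivation_sum ?c Y (\<lambda>l. h (l @ [z])) =
      derivation_sum ?c Y (\<lambda>l. nw (l @ [z]) + alternating_sum l (\<lambda>x l. ne (x # l @ [z])))"
    by (rule derivation_sum_cong) (use l in \<open>simp add: h_eq\<close>)
  then have B: "derivation_sum ?c Y (\<lambda>l. h (l @ [z])) =
      derivation_sum ?c Y (\<lambda>l. nw (l @ [z])) + alternating_sum Y (\<lambda>y l. ne (?c y # l @ [z]))
      + alternating_sum Y (\<lambda>y l. derivation_sum ?c l (\<lambda>l. ne (y # l @ [z])))"
    by (simp add: derivation_sum_add derivation_sum_alternating_sum add.assoc)
  have "alternating_sum Y (\<lambda>y l. ne (?c y # l @ [z])) =
      alternating_sum Y (\<lambda>y r. ne (v (X @ [y]) # r @ [z])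
        - alternating_sum X (\<lambda>x l. ne (v (y # l @ [x]) # r @ [z])))"
    by (rule alternating_sum_cong)
      (use l in \<open>simp add: C_snoc_v ne_diff[of "[]", simplified] ne_alternating_sum[of "[]", simplified]\<close>)
  then have c: "alternating_sum Y (\<lambda>y l. ne (?c y # l @ [z])) =
      alternating_sum Y (\<lambda>y l. ne (v (X @ [y]) # l @ [z]))
      - alternating_sum X (\<lambda>x l. alternating_sum Y (\<lambda>y r. ne (v (y # l @ [x]) # r @ [z])))"
    by (simp add: alternating_sum_diff alternating_sum_commute[of Y X])
  show ?thesis
    unfolding h_eq[OF l(1), of "h _"] h_eq[OF l(2), of "h _"] nwh[OF l] nwh[OF l(2,1)] A2 A3 B c
      D1_derivation[OF l]
    by (simp add: algebra_simps)
qed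

text \<open>The cancellation of \<open>h_h\<close> with the outer slots of \<nearrow> exchanged: the
  extracted commutator sits in the last slot, so it is expanded by \<open>C_snoc_h\<close>, whose
  halves come from \<open>D3\<close> and \<open>D6\<close>.\<close>

lemma v_v:
  assumes l: "Suc (length X) = n" "Suc (length Y) = n"
  shows "v (X @ [v (Y @ [z])]) =
    derivation_sum (\<lambda>y. C (X @ [y])) Y (\<lambda>l. v (l @ [z])) + v (Y @ [v (X @ [z])])"
proof -
  let ?c = "\<lambda>y. C (X @ [y])"
  have nwv: "nw (X @ [v (Y @ [z])]) =
      nw (X @ [nw (Y @ [z])]) - alternating_sum Y (\<lambda>y l. nw (X @ [ne (z # l @ [y])]))"
    if "Suc (length X) = n" "Suc (length Y) = n" for X Y
    using that by (simp add: v_eq nw_last)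
  have A2: "alternating_sum Y (\<lambda>y l. nw (X @ [ne (z # l @ [y])])) =
      alternating_sum Y (\<lambda>y l. ne (z # l @ [h (X @ [y])]))
      + alternating_sum Y (\<lambda>y l. ne (v (X @ [z]) # l @ [y]))
      + alternating_sum Y (\<lambda>y l. derivation_sum ?c l (\<lambda>l. ne (z # l @ [y])))"
    unfolding alternating_sum_add[symmetric]
    by (rule alternating_sum_cong, rule D3_derivation) (use l in auto)
  have A3: "alternating_sum X (\<lambda>x l. ne (v (Y @ [z]) # l @ [x])) =
      alternating_sum X (\<lambda>x l. nw (Y @ [ne (z # l @ [x])]))
      - alternating_sum X (\<lambda>x l. alternating_sum Y (\<lambda>y r. ne (z # r @ [h (y # l @ [x])])))"
    unfolding alternating_sum_diff[symmetric]
    by (rule alternating_sum_cong, rule D6_alternating) (use l in auto)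
  have "derivation_sum ?c Y (\<lambda>l. v (l @ [z])) =
      derivation_sum ?c Y (\<lambda>l. nw (l @ [z]) - alternating_sum l (\<lambda>x l. ne (z # l @ [x])))"
    by (rule derivation_sum_cong) (use l in \<open>simp add: v_eq\<close>)
  then have B: "derivation_sum ?c Y (\<lambda>l. v (l @ [z])) =
      derivation_sum ?c Y (\<lambda>l. nw (l @ [z])) - (alternating_sum Y (\<lambda>y l. ne (z # l @ [?c y]))
      + alternating_sum Y (\<lambda>y l. derivation_sum ?c l (\<lambda>l. ne (z # l @ [y]))))"
    by (simp add: derivation_sum_diff derivation_sum_alternating_sum)
  have "alternating_sum Y (\<lambda>y l. ne (z # l @ [?c y])) =
      alternating_sum Y (\<lambda>y r. ne (z # r @ [h (X @ [y])])
        - alternating_sum X (\<lambda>x l. ne (z # r @ [h (y # l @ [x])])))"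
    by (rule alternating_sum_cong)
      (use l in \<open>simp add: C_snoc_h ne_diff[of "z # _" "[]", simplified]
        ne_alternating_sum[of "z # _" "[]", simplified]\<close>)
  then have c: "alternating_sum Y (\<lambda>y l. ne (z # l @ [?c y])) =
      alternating_sum Y (\<lambda>y l. ne (z # l @ [h (X @ [y])]))
      - alternating_sum X (\<lambda>x l. alternating_sum Y (\<lambda>y r. ne (z # r @ [h (y # l @ [x])])))"
    by (simp add: alternating_sum_diff alternating_sum_commute[of Y X])
  show ?thesis
    unfolding v_eq[OF l(1), of "v _"] v_eq[OF l(2), of "v _"] nwv[OF l] nwv[OF l(2,1)] A2 A3 B c
      D1_derivation[OF l]
    by (simp add: algebra_simps)
qed

text \<open>In the \<nearrow> terms of the bracket, \<open>C X\<close> either stays in the middle,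
  where \<open>D4\<close> applies, or is extracted into the first slot, where it is expanded through
  \<open>v\<close> and \<open>D6\<close> applies. \<open>D6\<close> leaves a double sum over
  \<open>X\<close> with its two extracted entries in the wrong roles;
  \<open>alternating_sum_swap\<close> exchanges them and supplies the sign.\<close>

lemma h_C:
  assumes l: "length X = n" "Suc (length Y) = n"
  shows "h (C X # Y) = (-1) ^ Suc n *s alternating_sum X (\<lambda>x l. h (l @ [h (x # Y)]))"
proof -
  let ?e = "(-1) ^ Suc n :: 'k"
  obtain Y' b where Y: "Y = Y' @ [b]" using l n_ge_2 by (cases Y rule: rev_cases) auto
  have lY: "Suc (Suc (length Y')) = n" using l Y by simp
  have hx: "h (x # Y) = nw (x # Y) + ne (x # Y) - alternating_sum Y' (\<lambda>y r. ne (y # x # r @ [b]))" for x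
    using h_eq[of "x # Y'" b] lY by (simp add: Y)
  have "alternating_sum Y' (\<lambda>y r. ne (y # C X # r @ [b])) = alternating_sum Y' (\<lambda>y r.
      ?e *s alternating_sum X (\<lambda>x l. nw (l @ [ne (y # x # r @ [b])])))"
    by (rule alternating_sum_cong, rule D4_alternating) (use l lY in auto)
  then have L2: "alternating_sum Y' (\<lambda>y r. ne (y # C X # r @ [b])) =
      ?e *s alternating_sum X (\<lambda>x l. alternating_sum Y' (\<lambda>y r. nw (l @ [ne (y # x # r @ [b])])))"
    by (simp only: alternating_sum_scale alternating_sum_commute[of X Y'])
  have "ne (C X # Y) = ?e *s alternating_sum X (\<lambda>x l. ne (v (l @ [x]) # Y))"
    using l ne_scale[of "[]" Y ?e] ne_alternating_sum[of "[]" Y] by (simp only: C_eq_v) simp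
  also have "alternating_sum X (\<lambda>x l. ne (v (l @ [x]) # Y)) =
      alternating_sum X (\<lambda>x l. nw (l @ [ne (x # Y)]) - alternating_sum l (\<lambda>u r. ne (x # r @ [h (u # Y)])))"
    by (rule alternating_sum_cong, rule D6_alternating) (use l in auto)
  also have "\<dots> = alternating_sum X (\<lambda>x l. nw (l @ [ne (x # Y)]))
      + alternating_sum X (\<lambda>x l. alternating_sum l (\<lambda>u r. ne (u # r @ [h (x # Y)])))"
    by (subst alternating_sum_swap) (simp add: alternating_sum_diff)
  finally have L1: "ne (C X # Y) = ?e *s (alternating_sum X (\<lambda>x l. nw (l @ [ne (x # Y)]))
      + alternating_sum X (\<lambda>x l. alternating_sum l (\<lambda>u r. ne (u # r @ [h (x # Y)]))))" .
  have "alternating_sum X (\<lambda>x l. h (l @ [h (x # Y)])) = alternating_sum X (\<lambda>x l.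
      nw (l @ [nw (x # Y)]) + nw (l @ [ne (x # Y)])
      - alternating_sum Y' (\<lambda>y r. nw (l @ [ne (y # x # r @ [b])]))
      + alternating_sum l (\<lambda>u r. ne (u # r @ [h (x # Y)])))"
  proof (rule alternating_sum_cong)
    fix x and l' :: "'a list" assume l': "Suc (length l') = length X"
    then have "Suc (length l') = n" using l by simp
    then have "nw (l' @ [h (x # Y)]) = nw (l' @ [nw (x # Y)]) + nw (l' @ [ne (x # Y)])
        - alternating_sum Y' (\<lambda>y r. nw (l' @ [ne (y # x # r @ [b])]))"
      by (simp add: hx nw_last)
    then show "h (l' @ [h (x # Y)]) = nw (l' @ [nw (x # Y)]) + nw (l' @ [ne (x # Y)])
      - alternating_sum Y' (\<lambda>y r. nw (l' @ [ne (y # x # r @ [b])]))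
      + alternating_sum l' (\<lambda>u r. ne (u # r @ [h (x # Y)]))"
      using h_eq[of l' "h (x # Y)"] l l' by simp
  qed
  then have R: "alternating_sum X (\<lambda>x l. h (l @ [h (x # Y)])) =
      alternating_sum X (\<lambda>x l. nw (l @ [nw (x # Y)])) + alternating_sum X (\<lambda>x l. nw (l @ [ne (x # Y)]))
      - alternating_sum X (\<lambda>x l. alternating_sum Y' (\<lambda>y r. nw (l @ [ne (y # x # r @ [b])])))
      + alternating_sum X (\<lambda>x l. alternating_sum l (\<lambda>u r. ne (u # r @ [h (x # Y)])))"
    by (simp only: alternating_sum_add alternating_sum_diff)
  show ?thesis unfolding hx[of "C X"] L1 L2 R D2_alternating[OF l]
    by (simp only: scale_right_distrib scale_right_diff_distrib) (simp only: algebra_simps)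
qed

text \<open>As in \<open>h_C\<close>, but the extracted \<open>C X\<close> enters the last slot of
  \<nearrow>, so it is expanded through \<open>h\<close>, and \<open>D5_corrected\<close> takes the
  place of \<open>D6\<close>.\<close>

lemma v_C:
  assumes l: "length X = n" "Suc (length Y) = n"
  shows "v (C X # Y) = (-1) ^ Suc n *s alternating_sum X (\<lambda>x l. v (l @ [v (x # Y)]))"
proof -
  let ?e = "(-1) ^ Suc n :: 'k"
  obtain Y' b where Y: "Y = Y' @ [b]" using l n_ge_2 by (cases Y rule: rev_cases) auto
  have lY: "Suc (Suc (length Y')) = n" using l Y by simp
  have vx: "v (x # Y) = nw (x # Y) - ne (b # Y' @ [x])
      + alternating_sum Y' (\<lambda>y r. ne (b # x # r @ [y]))" for x
    using v_eq[of "x # Y'" b] lY by (simp add: Y)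
  have "alternating_sum Y' (\<lambda>y r. ne (b # C X # r @ [y])) = alternating_sum Y' (\<lambda>y r.
      ?e *s alternating_sum X (\<lambda>x l. nw (l @ [ne (b # x # r @ [y])])))"
    by (rule alternating_sum_cong, rule D4_alternating) (use l lY in auto)
  then have L2: "alternating_sum Y' (\<lambda>y r. ne (b # C X # r @ [y])) =
      ?e *s alternating_sum X (\<lambda>x l. alternating_sum Y' (\<lambda>y r. nw (l @ [ne (b # x # r @ [y])])))"
    by (simp only: alternating_sum_scale alternating_sum_commute[of X Y'])
  have "ne (b # Y' @ [C X]) = ?e *s alternating_sum X (\<lambda>x l. ne (b # Y' @ [h (l @ [x])]))"
    using l lY ne_scale[of "b # Y'" "[]" ?e] ne_alternating_sum[of "b # Y'" "[]"]
    by (simp only: C_eq_h) simp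
  also have "alternating_sum X (\<lambda>x l. ne (b # Y' @ [h (l @ [x])])) =
      alternating_sum X (\<lambda>x l. nw (l @ [ne (b # Y' @ [x])])
        - alternating_sum l (\<lambda>u r. ne (v (u # Y) # r @ [x])))"
    unfolding Y by (rule alternating_sum_cong, rule D5_corrected) (use l lY in auto)
  also have "\<dots> = alternating_sum X (\<lambda>x l. nw (l @ [ne (b # Y' @ [x])]))
      + alternating_sum X (\<lambda>x l. alternating_sum l (\<lambda>u r. ne (v (x # Y) # r @ [u])))"
    by (subst alternating_sum_swap) (simp add: alternating_sum_diff)
  finally have L1: "ne (b # Y' @ [C X]) = ?e *s (alternating_sum X (\<lambda>x l. nw (l @ [ne (b # Y' @ [x])]))
      + alternating_sum X (\<lambda>x l. alternating_sum l (\<lambda>u r. ne (v (x # Y) # r @ [u]))))" .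
  have "alternating_sum X (\<lambda>x l. v (l @ [v (x # Y)])) = alternating_sum X (\<lambda>x l.
      nw (l @ [nw (x # Y)]) - nw (l @ [ne (b # Y' @ [x])])
      + alternating_sum Y' (\<lambda>y r. nw (l @ [ne (b # x # r @ [y])]))
      - alternating_sum l (\<lambda>u r. ne (v (x # Y) # r @ [u])))"
  proof (rule alternating_sum_cong)
    fix x and l' :: "'a list" assume l': "Suc (length l') = length X"
    then have "Suc (length l') = n" using l by simp
    then have "nw (l' @ [v (x # Y)]) = nw (l' @ [nw (x # Y)]) - nw (l' @ [ne (b # Y' @ [x])])
        + alternating_sum Y' (\<lambda>y r. nw (l' @ [ne (b # x # r @ [y])]))"
      by (simp add: vx nw_last)
    then show "v (l' @ [v (x # Y)]) = nw (l' @ [nw (x # Y)]) - nw (l' @ [ne (b # Y' @ [x])])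
      + alternating_sum Y' (\<lambda>y r. nw (l' @ [ne (b # x # r @ [y])]))
      - alternating_sum l' (\<lambda>u r. ne (v (x # Y) # r @ [u]))"
      using v_eq[of l' "v (x # Y)"] l l' by simp
  qed
  then have R: "alternating_sum X (\<lambda>x l. v (l @ [v (x # Y)])) =
      alternating_sum X (\<lambda>x l. nw (l @ [nw (x # Y)]))
      - alternating_sum X (\<lambda>x l. nw (l @ [ne (b # Y' @ [x])]))
      + alternating_sum X (\<lambda>x l. alternating_sum Y' (\<lambda>y r. nw (l @ [ne (b # x # r @ [y])])))
      - alternating_sum X (\<lambda>x l. alternating_sum l (\<lambda>u r. ne (v (x # Y) # r @ [u])))"
    by (simp only: alternating_sum_add alternating_sum_diff)
  show ?thesis unfolding vx[of "C X"] L1 L2 R D2_alternating[OF l]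
    by (simp only: scale_right_distrib scale_right_diff_distrib) (simp only: algebra_simps)
qed

text \<open>Both brackets have commutator \<open>C\<close>, so one translation back to the indexed
  sums of the definition serves both.\<close>

lemma n_pre_lie_algebraI:
  assumes lin: "multilinear scale n br"
    and skew: "\<And>z k. Suc k = n \<Longrightarrow> skew_on_length k (\<lambda>l. br (l @ [z]))"
    and com: "\<And>xs. length xs = n \<Longrightarrow> n_commutator scale n br xs = C xs"
    and br_br: "\<And>X Y z. Suc (length X) = n \<Longrightarrow> Suc (length Y) = n \<Longrightarrow> br (X @ [br (Y @ [z])]) =
      derivation_sum (\<lambda>y. C (X @ [y])) Y (\<lambda>l. br (l @ [z])) + br (Y @ [br (X @ [z])])"
    and br_C: "\<And>X Y. length X = n \<Longrightarrow> Suc (length Y) = n \<Longrightarrow>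
      br (C X # Y) = (-1) ^ Suc n *s alternating_sum X (\<lambda>x l. br (l @ [br (x # Y)]))"
  shows "n_pre_lie_algebra scale Basis n br"
proof unfold_locales
  have n: "n = Suc (n - 1)" using n_ge_2 by simp
  show "2 \<le> n" by (rule n_ge_2)
  show "multilinear scale n br" by (rule lin)
  show "skew_symmetric_in {0..<n-1} n br"
    using skew_symmetric_inI[of "n - 1" br] skew n by metis
  fix xs ys :: "'a list" and z
  show "br (xs @ [br (ys @ [z])]) =
      (\<Sum>i=1..n-1. br (ys[i - 1 := n_commutator scale n br (xs @ [ys ! (i - 1)])] @ [z]))
      + br (ys @ [br (xs @ [z])])" if "length xs = n - 1" "length ys = n - 1"
    using br_br[of xs ys z] that n by (simp add: com derivation_sum_eq_sum)
  show "br (n_commutator scale n br xs # ys) =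
      (\<Sum>i=1..n. (-1) ^ (n - i) *s br (omit i xs @ [br (xs ! (i - 1) # ys)]))"
    if "length xs = n" "length ys = n - 1"
    using br_C[of xs ys] that n
      signed_sum_eq_alternating_sum[of xs n "\<lambda>x l. br (l @ [br (x # ys)])"] by (simp add: com)
qed

lemma n_pre_lie_algebra_h: "n_pre_lie_algebra scale Basis n h"
  by (rule n_pre_lie_algebraI[OF h_multilinear h_skew_block _ h_h h_C]) (simp_all add: C_def)

lemma n_pre_lie_algebra_v: "n_pre_lie_algebra scale Basis n v"
  by (rule n_pre_lie_algebraI[OF v_multilinear v_skew_block _ v_v v_C])
    (simp_all add: C_def h_def v_def n_commutator_horizontal_eq_vertical[OF vector_space_axioms])

end

theorem proposition5p1:
  fixes scale :: "'k::field_char_0 \<Rightarrow> 'a::ab_group_add \<Rightarrow> 'a"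
    and Basis :: "'a set"
    and n :: nat
    and nw ne :: "'a list \<Rightarrow> 'a"
  assumes "n_L_dendriform_algebra scale Basis n nw ne"
  shows "(n_pre_lie_algebra scale Basis n (horizontal_bracket scale n nw ne) \<and>
          compatible_n_L_dendriform scale Basis n (horizontal_bracket scale n nw ne) nw ne) \<and>
         (n_pre_lie_algebra scale Basis n (vertical_bracket scale n nw ne) \<and>
          compatible_n_L_dendriform scale Basis n (vertical_bracket scale n nw ne) nw ne)"
  using n_L_dendriform_algebra.n_pre_lie_algebra_h[OF assms]
    n_L_dendriform_algebra.n_pre_lie_algebra_v[OF assms] assms
  by (simp add: compatible_n_L_dendriform_def)

end
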